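(* Let $P:=R_1\cup\ldots\cup R_n$ be a general logic program such that $R_n\sqsupset\ldots\sqsupset R_1$ is a hierarchy, let $|\ |_1,\ldots,|\ |_n$ be level mappings for $R_1,\ldots,R_n$, respectively, and let $M$ be a complete model of $P$. Suppose that (1) $R_i$ is acceptable with respect to $|\ |_i$ and $M$, for all $i\in\{1,\ldots,n\}$; (2) $Q$ is a query strongly bounded with respect to $P$ and $|\ |_1,\ldots,|\ |_n$. Then all LDNF-derivations of $P\cup\{Q\}$ are finite.
   Context: **Programs.** All programs and queries are over a fixed first-order language with at least one constant. A literal is an atom or a negated atom. A (general) clause is $H\leftarrow L_1,\ldots,L_n$ ($n\ge 0$), $H$ an atom, $L_i$ literals. A (general) query is a finite, possibly empty, sequence of literals. A (general) program is a finite set of clauses. $\mathit{rel}(L)$ is the predicate symbol of $L$. $B_P$ is the set of ground atoms whose predicate symbol occurs in $P$; $\mathit{ground}(P)$ is the set of ground instances of clauses of $P$. **LDNF-resolution (leftmost selection rule).** For a program $P$ and a non-empty query $Q=L,\mathbf{L}$: (i) if $L=A$ is an atom, the resolvents of $Q$ are the queries $(\mathbf{B},\mathbf{L})\theta$ for $H\leftarrow\mathbf{B}$ a variant of a clause of $P$ renamed apart from $Q$ and $\theta=\mathrm{mgu}(A,H)$; (ii) if $L=\neg A$ with $A$ ground, a subsidiary LDNF-tree for $P\cup\{A\}$ is constructed; if this tree is finite and finitely failed, $Q$ has the single resolvent $\mathbf{L}$; if it is finite and has a successful branch, $Q$ fails; if its construction diverges, the derivation containing $Q$ is considered infinite; (iii)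 if $L=\neg A$ with $A$ non-ground, the derivation flounders: it ends (finitely) with no resolvent. A branch is successful if it ends in the empty query; it is failed if it ends in a query whose first literal is positive with no resolvent, or negative and ground with a finite subsidiary tree having a successful branch. A tree is finitely failed if it is finite and all its branches are failed. The branches of the LDNF-tree of $P\cup\{Q\}$ are its LDNF-derivations. The LDNF-descendants of $P\cup\{Q\}$ are all queries occurring during LDNF-resolution of $P\cup\{Q\}$, including $Q$ itself and all queries occurring in the construction of all (nested) subsidiary LDNF-trees. "All LDNF-derivations of $P\cup\{Q\}$ are finite" means that the interpreter terminates: there is no infinite sequence $Q=Q_0,Q_1,Q_2,\ldots$ where each $Q_{k+1}$ is a resolvent of $Q_k$ or, if $Q_k$ begins with a ground negative literal $\neg A$, the root $A$ of its subsidiary tree. $\mathit{first}(Q)$ is the first literal of a non-empty query, and $\mathit{Call}_P(Q)=\{\mathit{first}(Q') : Q' \text{ a (non-empty) LDNF-descendant of } P\cup\{Q\}\}$. **Level mappings, boundedness.** A level mapping for $P$ is a function $|\ |:B_P\to\mathbf{N}$, extended to ground literals by $|\neg A|=|A|$. An atom $A$ is bounded w.r.t. $|\ |$ if $\{|A'| : A' \text{ a ground instance of } A\}$ is finite. **Complete model.** $p$ refers to $q$ if some clause of $P$ has $p$ in its head and $q$ in its body; "depends on" is the reflexive transitive closure of "refers to". $\mathit{Neg}_P$ is the set of relations occurring in a negative literal in a clause of $P$; $\mathit{Neg}^*_P$ is the set of relations on which relations in $\mathit{Neg}_P$ depend; $P^-$ is the set of clauses of $P$ defining relations in $\mathit{Neg}^*_P$.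 A model $M$ of $P$ is complete if its restriction to the relations in $\mathit{Neg}^*_P$ is a model of Clark's completion $\mathit{comp}(P^-)$ (with the free equality axioms; a relation in $\mathit{Neg}^*_P$ having no clauses is completed by $\forall \mathbf{x}\,\neg p(\mathbf{x})$). **Acceptability.** Let $|\ |_i$ be a level mapping for the module $R_i$ and $M$ a complete model (here: of the whole program $P$). $R_i$ is acceptable w.r.t. $|\ |_i$ and $M$ if for every clause $A\leftarrow\mathbf{A},B,\mathbf{B}$ in $\mathit{ground}(R_i)$ (with $B$ a literal and $\mathbf{A},\mathbf{B}$ sequences of literals): if $M\models\mathbf{A}$ then $|A|_i>|B|_i$. **Hierarchy.** A relation is defined in $P$ if it occurs in the head of a clause of $P$; a literal $L$ is defined in $P$ if $\mathit{rel}(L)$ is. $P$ extends $R$, written $P\sqsupset R$, if no relation defined in $P$ occurs in $R$. $R_n\sqsupset\cdots\sqsupset R_1$ is a hierarchy if $R_{i+1}\sqsupset(R_1\cup\cdots\cup R_i)$ for all $i\in\{1,\ldots,n-1\}$. **Strong boundedness.** For such a hierarchy with $P=R_1\cup\ldots\cup R_n$ and level mappings $|\ |_i$ for $R_i$, a query $Q$ is strongly bounded w.r.t. $P$ and $|\ |_1,\ldots,|\ |_n$ if for all atoms $A\in\mathit{Call}_P(Q)$ and all $i\in\{1,\ldots,n\}$, if $A$ is defined in $R_i$ then $A$ is bounded w.r.t. $|\ |_i$. *)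

theory Defs
  imports Main "HOL-Library.Infinite_Typeclass"
begin

section \<open>Syntax of general logic programs\<close>

text \<open>The function and relation symbols of the language are all the elements of the types
  \<open>'f\<close> and \<open>'p\<close>; their arities are given by a signature.  Syntactic
  objects of the language are the well-formed ones.\<close>

record ('p, 'f) signature =
  fun_arity :: "'f \<Rightarrow> nat"
  rel_arity :: "'p \<Rightarrow> nat"

definition has_constant :: "('p, 'f) signature \<Rightarrow> bool" where
  "has_constant L \<longleftrightarrow> (\<exists>c. fun_arity L c = 0)"

datatype ('f, 'v) trm = Var 'v | Fun 'f "('f, 'v) trm list"

datatype ('p, 'f, 'v) atom = Atom (rel_of: 'p) (args_of: "('f, 'v) trm list")

datatype ('p, 'f, 'v) literal =
    Pos (atom_of: "('p, 'f, 'v) atom")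
  | Neg (atom_of: "('p, 'f, 'v) atom")

type_synonym ('p, 'f, 'v) query = "('p, 'f, 'v) literal list"

text \<open>The pair \<open>(H, Ls)\<close> is the clause with head \<open>H\<close> and body \<open>Ls\<close>.\<close>

type_synonym ('p, 'f, 'v) clause = "('p, 'f, 'v) atom \<times> ('p, 'f, 'v) literal list"

type_synonym ('p, 'f, 'v) prog = "('p, 'f, 'v) clause set"

fun wf_term :: "('p, 'f) signature \<Rightarrow> ('f, 'v) trm \<Rightarrow> bool" where
  "wf_term L (Var x) \<longleftrightarrow> True"
| "wf_term L (Fun f ts) \<longleftrightarrow> length ts = fun_arity L f \<and> (\<forall>t \<in> set ts. wf_term L t)"

definition wf_atom :: "('p, 'f) signature \<Rightarrow> ('p, 'f, 'v) atom \<Rightarrow> bool" where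
  "wf_atom L A \<longleftrightarrow>
     length (args_of A) = rel_arity L (rel_of A) \<and> (\<forall>t \<in> set (args_of A). wf_term L t)"

definition wf_query :: "('p, 'f) signature \<Rightarrow> ('p, 'f, 'v) query \<Rightarrow> bool" where
  "wf_query L Q \<longleftrightarrow> (\<forall>l \<in> set Q. wf_atom L (atom_of l))"

definition program :: "('p, 'f) signature \<Rightarrow> ('p, 'f, 'v) prog \<Rightarrow> bool" where
  "program L P \<longleftrightarrow> finite P \<and> (\<forall>(H, Ls) \<in> P. wf_atom L H \<and> wf_query L Ls)"

fun vars_term :: "('f, 'v) trm \<Rightarrow> 'v set" where
  "vars_term (Var x) = {x}"
| "vars_term (Fun f ts) = (\<Union>t \<in> set ts. vars_term t)"

definition vars_atom :: "('p, 'f, 'v) atom \<Rightarrow> 'v set" where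
  "vars_atom A = (\<Union>t \<in> set (args_of A). vars_term t)"

definition vars_query :: "('p, 'f, 'v) query \<Rightarrow> 'v set" where
  "vars_query Q = (\<Union>l \<in> set Q. vars_atom (atom_of l))"

fun vars_clause :: "('p, 'f, 'v) clause \<Rightarrow> 'v set" where
  "vars_clause (H, Ls) = vars_atom H \<union> vars_query Ls"

section \<open>Substitutions\<close>

type_synonym ('f, 'v) subst = "'v \<Rightarrow> ('f, 'v) trm"

fun subst_term :: "('f, 'v) subst \<Rightarrow> ('f, 'v) trm \<Rightarrow> ('f, 'v) trm" where
  "subst_term \<sigma> (Var x) = \<sigma> x"
| "subst_term \<sigma> (Fun f ts) = Fun f (map (subst_term \<sigma>) ts)"

fun subst_atom :: "('f, 'v) subst \<Rightarrow> ('p, 'f, 'v) atom \<Rightarrow> ('p, 'f, 'v) atom" where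
  "subst_atom \<sigma> (Atom p ts) = Atom p (map (subst_term \<sigma>) ts)"

fun subst_lit :: "('f, 'v) subst \<Rightarrow> ('p, 'f, 'v) literal \<Rightarrow> ('p, 'f, 'v) literal" where
  "subst_lit \<sigma> (Pos A) = Pos (subst_atom \<sigma> A)"
| "subst_lit \<sigma> (Neg A) = Neg (subst_atom \<sigma> A)"

definition subst_query :: "('f, 'v) subst \<Rightarrow> ('p, 'f, 'v) query \<Rightarrow> ('p, 'f, 'v) query" where
  "subst_query \<sigma> Q = map (subst_lit \<sigma>) Q"

fun subst_clause :: "('f, 'v) subst \<Rightarrow> ('p, 'f, 'v) clause \<Rightarrow> ('p, 'f, 'v) clause" where
  "subst_clause \<sigma> (H, Ls) = (subst_atom \<sigma> H, subst_query \<sigma> Ls)"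

definition wf_subst :: "('p, 'f) signature \<Rightarrow> ('f, 'v) subst \<Rightarrow> bool" where
  "wf_subst L \<sigma> \<longleftrightarrow> (\<forall>x. wf_term L (\<sigma> x))"

definition renaming :: "('f, 'v) subst \<Rightarrow> bool" where
  "renaming \<rho> \<longleftrightarrow> (\<exists>\<pi>. bij \<pi> \<and> \<rho> = (\<lambda>x. Var (\<pi> x)))"

definition is_mgu ::
  "('p, 'f) signature \<Rightarrow> ('f, 'v) subst \<Rightarrow> ('p, 'f, 'v) atom \<Rightarrow> ('p, 'f, 'v) atom \<Rightarrow> bool" where
  "is_mgu L \<theta> A B \<longleftrightarrow>
     wf_subst L \<theta> \<and> subst_atom \<theta> A = subst_atom \<theta> B \<and>
     (\<forall>\<sigma>. wf_subst L \<sigma> \<and> subst_atom \<sigma> A = subst_atom \<sigma> B \<longrightarrow>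
        (\<exists>\<delta>. wf_subst L \<delta> \<and> (\<forall>x. \<sigma> x = subst_term \<delta> (\<theta> x))))"

definition ground_instances ::
  "('p, 'f) signature \<Rightarrow> ('p, 'f, 'v) atom \<Rightarrow> ('p, 'f, 'v) atom set" where
  "ground_instances L A =
     {subst_atom \<sigma> A | \<sigma>. wf_subst L \<sigma> \<and> vars_atom (subst_atom \<sigma> A) = {}}"

definition ground_prog :: "('p, 'f) signature \<Rightarrow> ('p, 'f, 'v) prog \<Rightarrow> ('p, 'f, 'v) prog" where
  "ground_prog L P =
     {subst_clause \<sigma> C | \<sigma> C. C \<in> P \<and> wf_subst L \<sigma> \<and> vars_clause (subst_clause \<sigma> C) = {}}"

section \<open>LDNF-resolution\<close>

text \<open>Resolvents of the query with first literal \<open>Pos A\<close> and remaining literals \<open>Ls\<close>,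
  for every choice of the variant of the program clause and of the mgu.\<close>

definition pos_resolvent ::
  "('p, 'f) signature \<Rightarrow> ('p, 'f, 'v) prog \<Rightarrow> ('p, 'f, 'v) atom \<Rightarrow> ('p, 'f, 'v) query \<Rightarrow>
   ('p, 'f, 'v) query \<Rightarrow> bool" where
  "pos_resolvent L P A Ls Q' \<longleftrightarrow>
     (\<exists>C \<in> P. \<exists>\<rho> H B \<theta>. renaming \<rho> \<and> subst_clause \<rho> C = (H, B) \<and>
        vars_clause (H, B) \<inter> vars_query (Pos A # Ls) = {} \<and>
        is_mgu L \<theta> A H \<and> Q' = subst_query \<theta> (B @ Ls))"

text \<open>\<open>ldnf_tree L P Q S\<close> holds iff the construction of the LDNF-tree of \<open>Q\<close>,
  including that of all its nested subsidiary trees, terminates; \<open>S\<close> is then the set of the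
  ways in which its branches end.  \<open>S\<close> is uniquely determined by \<open>Q\<close> and non-empty.
  There is no rule for a query whose subsidiary tree diverges, since the derivation
  containing it counts as infinite.  If the subsidiary tree is finite, but neither finitely failed
  nor with a successful branch, then one of its branches flounders, and the main branch
  ends there, neither successful nor failed.\<close>

datatype outcome = Successful | Failed | Floundered

inductive ldnf_tree ::
  "('p, 'f) signature \<Rightarrow> ('p, 'f, 'v) prog \<Rightarrow> ('p, 'f, 'v) query \<Rightarrow> outcome set \<Rightarrow> bool"
  for L P where
  empty: "ldnf_tree L P [] {Successful}"
| no_resolvent: "\<nexists>Q'. pos_resolvent L P A Ls Q' \<Longrightarrow> ldnf_tree L P (Pos A # Ls) {Failed}"
| resolvents:
    "\<exists>Q'. pos_resolvent L P A Ls Q' \<Longrightarrow>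
     (\<And>Q'. pos_resolvent L P A Ls Q' \<Longrightarrow> ldnf_tree L P Q' (F Q')) \<Longrightarrow>
     ldnf_tree L P (Pos A # Ls) (\<Union>Q' \<in> Collect (pos_resolvent L P A Ls). F Q')"
| nonground: "vars_atom A \<noteq> {} \<Longrightarrow> ldnf_tree L P (Neg A # Ls) {Floundered}"
| subsidiary_failed:
    "vars_atom A = {} \<Longrightarrow> ldnf_tree L P [Pos A] {Failed} \<Longrightarrow> ldnf_tree L P Ls S \<Longrightarrow>
     ldnf_tree L P (Neg A # Ls) S"
| subsidiary_successful:
    "vars_atom A = {} \<Longrightarrow> ldnf_tree L P [Pos A] T \<Longrightarrow> Successful \<in> T \<Longrightarrow>
     ldnf_tree L P (Neg A # Ls) {Failed}"
| subsidiary_floundered: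
    "vars_atom A = {} \<Longrightarrow> ldnf_tree L P [Pos A] T \<Longrightarrow> Successful \<notin> T \<Longrightarrow> T \<noteq> {Failed} \<Longrightarrow>
     ldnf_tree L P (Neg A # Ls) {Floundered}"

definition finitely_failed ::
  "('p, 'f) signature \<Rightarrow> ('p, 'f, 'v) prog \<Rightarrow> ('p, 'f, 'v) query \<Rightarrow> bool" where
  "finitely_failed L P Q \<longleftrightarrow> ldnf_tree L P Q {Failed}"

inductive resolvent ::
  "('p, 'f) signature \<Rightarrow> ('p, 'f, 'v) prog \<Rightarrow> ('p, 'f, 'v) query \<Rightarrow> ('p, 'f, 'v) query \<Rightarrow> bool"
  for L P where
  positive: "pos_resolvent L P A Ls Q' \<Longrightarrow> resolvent L P (Pos A # Ls) Q'"
| negative: "vars_atom A = {} \<Longrightarrow> finitely_failed L P [Pos A] \<Longrightarrow> resolvent L P (Neg A # Ls) Ls"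

inductive ldnf_step ::
  "('p, 'f) signature \<Rightarrow> ('p, 'f, 'v) prog \<Rightarrow> ('p, 'f, 'v) query \<Rightarrow> ('p, 'f, 'v) query \<Rightarrow> bool"
  for L P where
  resolve: "resolvent L P Q Q' \<Longrightarrow> ldnf_step L P Q Q'"
| subsidiary: "vars_atom A = {} \<Longrightarrow> ldnf_step L P (Neg A # Ls) [Pos A]"

definition ldnf_descendants ::
  "('p, 'f) signature \<Rightarrow> ('p, 'f, 'v) prog \<Rightarrow> ('p, 'f, 'v) query \<Rightarrow> ('p, 'f, 'v) query set" where
  "ldnf_descendants L P Q = {Q'. (ldnf_step L P)\<^sup>*\<^sup>* Q Q'}"

definition Call ::
  "('p, 'f) signature \<Rightarrow> ('p, 'f, 'v) prog \<Rightarrow> ('p, 'f, 'v) query \<Rightarrow> ('p, 'f, 'v) literal set" where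
  "Call L P Q = {hd Q' | Q'. Q' \<in> ldnf_descendants L P Q \<and> Q' \<noteq> []}"

definition all_ldnf_derivations_finite ::
  "('p, 'f) signature \<Rightarrow> ('p, 'f, 'v) prog \<Rightarrow> ('p, 'f, 'v) query \<Rightarrow> bool" where
  "all_ldnf_derivations_finite L P Q \<longleftrightarrow>
     \<not> (\<exists>q :: nat \<Rightarrow> ('p, 'f, 'v) query.
          q 0 = Q \<and> (\<forall>k. ldnf_step L P (q k) (q (Suc k))))"

section \<open>Relations of a program\<close>

definition defined_rels :: "('p, 'f, 'v) prog \<Rightarrow> 'p set" where
  "defined_rels P = {rel_of H | H Ls. (H, Ls) \<in> P}"

definition occurring_rels :: "('p, 'f, 'v) prog \<Rightarrow> 'p set" where
  "occurring_rels P =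
     defined_rels P \<union> {rel_of (atom_of l) | l H Ls. (H, Ls) \<in> P \<and> l \<in> set Ls}"

definition extends :: "('p, 'f, 'v) prog \<Rightarrow> ('p, 'f, 'v) prog \<Rightarrow> bool" where
  "extends P R \<longleftrightarrow> defined_rels P \<inter> occurring_rels R = {}"

definition hierarchy :: "nat \<Rightarrow> (nat \<Rightarrow> ('p, 'f, 'v) prog) \<Rightarrow> bool" where
  "hierarchy n R \<longleftrightarrow> (\<forall>i. 1 \<le> i \<and> i < n \<longrightarrow> extends (R (Suc i)) (\<Union>j \<in> {1..i}. R j))"

definition refers_to :: "('p, 'f, 'v) prog \<Rightarrow> 'p \<Rightarrow> 'p \<Rightarrow> bool" where
  "refers_to P p q \<longleftrightarrow>
     (\<exists>H Ls l. (H, Ls) \<in> P \<and> rel_of H = p \<and> l \<in> set Ls \<and> rel_of (atom_of l) = q)"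

definition depends_on :: "('p, 'f, 'v) prog \<Rightarrow> 'p \<Rightarrow> 'p \<Rightarrow> bool" where
  "depends_on P = (refers_to P)\<^sup>*\<^sup>*"

definition neg_rels :: "('p, 'f, 'v) prog \<Rightarrow> 'p set" where
  "neg_rels P = {rel_of A | A H Ls. (H, Ls) \<in> P \<and> Neg A \<in> set Ls}"

definition neg_rels_star :: "('p, 'f, 'v) prog \<Rightarrow> 'p set" where
  "neg_rels_star P = {q. \<exists>p \<in> neg_rels P. depends_on P p q}"

definition neg_part :: "('p, 'f, 'v) prog \<Rightarrow> ('p, 'f, 'v) prog" where
  "neg_part P = {(H, Ls) \<in> P. rel_of H \<in> neg_rels_star P}"

section \<open>Interpretations and complete models\<close>

text \<open>First-order interpretations with domain \<open>'d\<close>, not only Herbrand ones.  Equality is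
  interpreted as identity on \<open>'d\<close>.\<close>

record ('p, 'f, 'd) interp =
  fun_interp :: "'f \<Rightarrow> 'd list \<Rightarrow> 'd"
  rel_interp :: "'p \<Rightarrow> 'd list \<Rightarrow> bool"

fun eval :: "('p, 'f, 'd) interp \<Rightarrow> ('v \<Rightarrow> 'd) \<Rightarrow> ('f, 'v) trm \<Rightarrow> 'd" where
  "eval M v (Var x) = v x"
| "eval M v (Fun f ts) = fun_interp M f (map (eval M v) ts)"

fun sat_atom :: "('p, 'f, 'd) interp \<Rightarrow> ('v \<Rightarrow> 'd) \<Rightarrow> ('p, 'f, 'v) atom \<Rightarrow> bool" where
  "sat_atom M v (Atom p ts) \<longleftrightarrow> rel_interp M p (map (eval M v) ts)"

fun sat_lit :: "('p, 'f, 'd) interp \<Rightarrow> ('v \<Rightarrow> 'd) \<Rightarrow> ('p, 'f, 'v) literal \<Rightarrow> bool" where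
  "sat_lit M v (Pos A) \<longleftrightarrow> sat_atom M v A"
| "sat_lit M v (Neg A) \<longleftrightarrow> \<not> sat_atom M v A"

definition sat_query :: "('p, 'f, 'd) interp \<Rightarrow> ('v \<Rightarrow> 'd) \<Rightarrow> ('p, 'f, 'v) query \<Rightarrow> bool" where
  "sat_query M v Q \<longleftrightarrow> (\<forall>l \<in> set Q. sat_lit M v l)"

definition models_query :: "('p, 'f, 'd) interp \<Rightarrow> ('p, 'f, 'v) query \<Rightarrow> bool" where
  "models_query M Q \<longleftrightarrow> (\<forall>v. sat_query M v Q)"

definition is_model :: "('p, 'f, 'd) interp \<Rightarrow> ('p, 'f, 'v) prog \<Rightarrow> bool" where
  "is_model M P \<longleftrightarrow> (\<forall>(H, Ls) \<in> P. \<forall>v. sat_query M v Ls \<longrightarrow> sat_atom M v H)"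

text \<open>The axioms are those for the whole language.  The type argument fixes the type of the
  variables of the terms in the occurs-check axioms.\<close>

definition free_equality ::
  "'v itself \<Rightarrow> ('p, 'f) signature \<Rightarrow> ('p, 'f, 'd) interp \<Rightarrow> bool" where
  "free_equality TYPE('v) L M \<longleftrightarrow>
     (\<forall>f ds es. length ds = fun_arity L f \<and> length es = fun_arity L f \<and>
        fun_interp M f ds = fun_interp M f es \<longrightarrow> ds = es) \<and>
     (\<forall>f g ds es. f \<noteq> g \<and> length ds = fun_arity L f \<and> length es = fun_arity L g \<longrightarrow>
        fun_interp M f ds \<noteq> fun_interp M g es) \<and>
     (\<forall>(x :: 'v) t v. wf_term L t \<and> x \<in> vars_term t \<and> t \<noteq> Var x \<longrightarrow> eval M v t \<noteq> v x)"

text \<open>Truth in \<open>M\<close> of Clark's completion of \<open>P\<close> over the relations in \<open>N\<close>.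
  The second conjunct is the truth of the completed definition
  \<open>\<forall>xs. p(xs) \<longleftrightarrow> (\<Or>C. \<exists>ys. xs = ts \<and> Ls)\<close> of \<open>p\<close>, where \<open>C\<close> ranges over
  the clauses \<open>p(ts) \<leftarrow> Ls\<close> of \<open>P\<close> and \<open>ys\<close> are the variables of \<open>C\<close>; for a
  relation without clauses it is \<open>\<forall>xs. \<not> p(xs)\<close>.\<close>

definition is_model_of_completion ::
  "('p, 'f) signature \<Rightarrow> 'p set \<Rightarrow> ('p, 'f, 'd) interp \<Rightarrow> ('p, 'f, 'v) prog \<Rightarrow> bool" where
  "is_model_of_completion L N M P \<longleftrightarrow>
     free_equality TYPE('v) L M \<and>
     (\<forall>p \<in> N. \<forall>ds. length ds = rel_arity L p \<longrightarrow>
        (rel_interp M p ds \<longleftrightarrow>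
           (\<exists>ts Ls (v :: 'v \<Rightarrow> 'd).
              (Atom p ts, Ls) \<in> P \<and> ds = map (eval M v) ts \<and> sat_query M v Ls)))"

text \<open>All relations occurring in \<open>neg_part P\<close> belong to \<open>neg_rels_star P\<close>, so
  the completion below does not depend on the other relations of \<open>M\<close>: there is no need to
  restrict \<open>M\<close> explicitly.\<close>

definition complete_model ::
  "('p, 'f) signature \<Rightarrow> ('p, 'f, 'v) prog \<Rightarrow> ('p, 'f, 'd) interp \<Rightarrow> bool" where
  "complete_model L P M \<longleftrightarrow>
     is_model M P \<and> is_model_of_completion L (neg_rels_star P) M (neg_part P)"

section \<open>Level mappings\<close>

text \<open>A level mapping for \<open>P\<close> is represented by a total function on atoms, of which only
  the values at well-formed ground atoms with a relation occurring in \<open>P\<close> are relevant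
  for \<open>acceptable\<close> and \<open>strongly_bounded\<close>.\<close>

type_synonym ('p, 'f, 'v) level_mapping = "('p, 'f, 'v) atom \<Rightarrow> nat"

definition lit_level :: "('p, 'f, 'v) level_mapping \<Rightarrow> ('p, 'f, 'v) literal \<Rightarrow> nat" where
  "lit_level lvl l = lvl (atom_of l)"

definition bounded_atom ::
  "('p, 'f) signature \<Rightarrow> ('p, 'f, 'v) level_mapping \<Rightarrow> ('p, 'f, 'v) atom \<Rightarrow> bool" where
  "bounded_atom L lvl A \<longleftrightarrow> finite (lvl ` ground_instances L A)"

definition acceptable ::
  "('p, 'f) signature \<Rightarrow> ('p, 'f, 'v) prog \<Rightarrow> ('p, 'f, 'v) level_mapping \<Rightarrow>
   ('p, 'f, 'd) interp \<Rightarrow> bool" where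
  "acceptable L R lvl M \<longleftrightarrow>
     (\<forall>A As B Bs. (A, As @ B # Bs) \<in> ground_prog L R \<longrightarrow> models_query M As \<longrightarrow>
        lvl A > lit_level lvl B)"

definition strongly_bounded ::
  "('p, 'f) signature \<Rightarrow> nat \<Rightarrow> (nat \<Rightarrow> ('p, 'f, 'v) prog) \<Rightarrow>
   (nat \<Rightarrow> ('p, 'f, 'v) level_mapping) \<Rightarrow> ('p, 'f, 'v) query \<Rightarrow> bool" where
  "strongly_bounded L n R lvl Q \<longleftrightarrow>
     (\<forall>A i. Pos A \<in> Call L (\<Union>j \<in> {1..n}. R j) Q \<and> i \<in> {1..n} \<and>
        rel_of A \<in> defined_rels (R i) \<longrightarrow> bounded_atom L (lvl i) A)"

end

theory Submission
  imports Defs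
begin

text \<open>An infinite derivation would contain an infinite chain of selected literals each of which is
  a body literal of a clause used to resolve its predecessor, or the atom of a negated predecessor.
  Along such a chain the index of the defining module never increases.  While it stays equal to
  \<open>i\<close>, each selected atom is bounded with respect to the \<open>i\<close>-th level mapping, and the maximum
  of the levels of its ground instances decreases by acceptability: when a body literal is
  selected, the computed answer of the preceding body literals is true in the complete model.  This
  last fact rests on the soundness of finite failure for Clark's completion, and there the free
  equality axioms are needed, in the form that a model satisfying an equation of atoms
  factors through an mgu of them.\<close>

section \<open>Substitutions and evaluation\<close>

lemma subst_term_subst_term:
  "subst_term \<delta> (subst_term \<theta> t) = subst_term (\<lambda>x. subst_term \<delta> (\<theta> x)) t"
  by (induction t) auto

lemma subst_atom_subst_atom:
  "subst_atom \<delta> (subst_atom \<theta> A) = subst_atom (\<lambda>x. subst_term \<delta> (\<theta> x)) A"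
  by (cases A) (simp add: subst_term_subst_term)

lemma subst_lit_subst_lit:
  "subst_lit \<delta> (subst_lit \<theta> l) = subst_lit (\<lambda>x. subst_term \<delta> (\<theta> x)) l"
  by (cases l) (simp_all add: subst_atom_subst_atom)

lemma subst_query_subst_query:
  "subst_query \<delta> (subst_query \<theta> Q) = subst_query (\<lambda>x. subst_term \<delta> (\<theta> x)) Q"
  by (simp add: subst_query_def subst_lit_subst_lit)

lemma subst_term_Var [simp]: "subst_term Var t = t"
  by (induction t) (auto intro: map_idI)

lemma subst_atom_Var [simp]: "subst_atom Var A = A"
  by (cases A) (auto intro: map_idI)

lemma subst_lit_Var [simp]: "subst_lit Var l = l"
  by (cases l) auto

lemma subst_query_Var [simp]: "subst_query Var Q = Q"
  by (auto simp: subst_query_def intro: map_idI)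

lemma subst_query_simps [simp]:
  "subst_query \<theta> [] = []"
  "subst_query \<theta> (l # Q) = subst_lit \<theta> l # subst_query \<theta> Q"
  "subst_query \<theta> (Q @ Q') = subst_query \<theta> Q @ subst_query \<theta> Q'"
  by (simp_all add: subst_query_def)

lemma subst_term_cong: "(\<And>x. x \<in> vars_term t \<Longrightarrow> \<sigma> x = \<tau> x) \<Longrightarrow> subst_term \<sigma> t = subst_term \<tau> t"
  by (induction t) auto

lemma subst_atom_cong: "(\<And>x. x \<in> vars_atom A \<Longrightarrow> \<sigma> x = \<tau> x) \<Longrightarrow> subst_atom \<sigma> A = subst_atom \<tau> A"
  by (cases A) (auto simp: vars_atom_def intro!: subst_term_cong)

lemma subst_atom_ground: "vars_atom A = {} \<Longrightarrow> subst_atom \<sigma> A = A"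
  using subst_atom_cong[of A \<sigma> Var] by simp

lemma rel_of_subst_atom [simp]: "rel_of (subst_atom \<sigma> A) = rel_of A"
  by (cases A) simp

lemma atom_of_subst_lit [simp]: "atom_of (subst_lit \<sigma> l) = subst_atom \<sigma> (atom_of l)"
  by (cases l) auto

lemma finite_vars_term [simp]: "finite (vars_term t)"
  by (induction t) auto

lemma finite_vars_atom [simp]: "finite (vars_atom A)"
  by (simp add: vars_atom_def)

lemma finite_vars_query [simp]: "finite (vars_query Q)"
  by (simp add: vars_query_def)

lemma finite_vars_clause [simp]: "finite (vars_clause C)"
  by (cases C) simp

lemma vars_query_simps [simp]:
  "vars_query [] = {}"
  "vars_query (l # Q) = vars_atom (atom_of l) \<union> vars_query Q"
  "vars_query (Q @ Q') = vars_query Q \<union> vars_query Q'"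
  by (auto simp: vars_query_def)

lemma vars_term_subst: "vars_term (subst_term \<sigma> t) = (\<Union>x \<in> vars_term t. vars_term (\<sigma> x))"
  by (induction t) auto

lemma vars_atom_subst: "vars_atom (subst_atom \<sigma> A) = (\<Union>x \<in> vars_atom A. vars_term (\<sigma> x))"
  by (cases A) (auto simp: vars_atom_def vars_term_subst)

lemma vars_query_subst: "vars_query (subst_query \<sigma> Q) = (\<Union>x \<in> vars_query Q. vars_term (\<sigma> x))"
  by (induction Q) (auto simp: vars_atom_subst)

lemma wf_subst_term: "wf_subst L \<sigma> \<Longrightarrow> wf_term L t \<Longrightarrow> wf_term L (subst_term \<sigma> t)"
  by (induction t) (auto simp: wf_subst_def)

lemma wf_subst_atom: "wf_subst L \<sigma> \<Longrightarrow> wf_atom L A \<Longrightarrow> wf_atom L (subst_atom \<sigma> A)"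
  by (cases A) (auto simp: wf_atom_def wf_subst_term)

lemma wf_subst_query: "wf_subst L \<sigma> \<Longrightarrow> wf_query L Q \<Longrightarrow> wf_query L (subst_query \<sigma> Q)"
  by (auto simp: wf_query_def subst_query_def wf_subst_atom)

lemma wf_subst_comp: "wf_subst L \<sigma> \<Longrightarrow> wf_subst L \<theta> \<Longrightarrow> wf_subst L (\<lambda>x. subst_term \<sigma> (\<theta> x))"
  using wf_subst_term[of L \<sigma>] by (simp add: wf_subst_def)

lemma wf_subst_Var [simp]: "wf_subst L Var"
  by (simp add: wf_subst_def)

lemma wf_subst_renaming: "renaming \<rho> \<Longrightarrow> wf_subst L \<rho>"
  by (auto simp: renaming_def wf_subst_def)

lemma wf_query_simps [simp]:
  "wf_query L []"
  "wf_query L (l # Q) \<longleftrightarrow> wf_atom L (atom_of l) \<and> wf_query L Q"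
  "wf_query L (Q @ Q') \<longleftrightarrow> wf_query L Q \<and> wf_query L Q'"
  by (auto simp: wf_query_def)

section \<open>Evaluation and truth under substitutions\<close>

lemma eval_subst: "eval M v (subst_term \<theta> t) = eval M (\<lambda>x. eval M v (\<theta> x)) t"
  by (induction t) (auto simp: comp_def cong: map_cong)

lemma sat_atom_subst: "sat_atom M v (subst_atom \<theta> A) \<longleftrightarrow> sat_atom M (\<lambda>x. eval M v (\<theta> x)) A"
  by (cases A) (simp add: eval_subst comp_def)

lemma sat_lit_subst: "sat_lit M v (subst_lit \<theta> l) \<longleftrightarrow> sat_lit M (\<lambda>x. eval M v (\<theta> x)) l"
  by (cases l) (simp_all add: sat_atom_subst)

lemma sat_query_subst:
  "sat_query M v (subst_query \<theta> Q) \<longleftrightarrow> sat_query M (\<lambda>x. eval M v (\<theta> x)) Q"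
  by (simp add: sat_query_def subst_query_def sat_lit_subst)

lemma sat_query_simps [simp]:
  "sat_query M v []"
  "sat_query M v (l # Q) \<longleftrightarrow> sat_lit M v l \<and> sat_query M v Q"
  "sat_query M v (Q @ Q') \<longleftrightarrow> sat_query M v Q \<and> sat_query M v Q'"
  by (auto simp: sat_query_def)

lemma eval_cong: "(\<And>x. x \<in> vars_term t \<Longrightarrow> v x = w x) \<Longrightarrow> eval M v t = eval M w t"
proof (induction t)
  case (Fun f ts)
  then have "map (eval M v) ts = map (eval M w) ts" by auto
  then show ?case by (simp only: eval.simps)
qed simp

lemma sat_atom_cong:
  assumes "\<And>x. x \<in> vars_atom A \<Longrightarrow> v x = w x"
  shows "sat_atom M v A \<longleftrightarrow> sat_atom M w A"
proof (cases A)
  case (Atom p ts)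
  with assms have "map (eval M v) ts = map (eval M w) ts"
    by (auto simp: vars_atom_def intro!: eval_cong)
  then show ?thesis by (simp only: Atom sat_atom.simps)
qed

lemma sat_lit_cong:
  "(\<And>x. x \<in> vars_atom (atom_of l) \<Longrightarrow> v x = w x) \<Longrightarrow> sat_lit M v l \<longleftrightarrow> sat_lit M w l"
  using sat_atom_cong[of "atom_of l" v w M] by (cases l) auto

lemma sat_query_cong:
  "(\<And>x. x \<in> vars_query Q \<Longrightarrow> v x = w x) \<Longrightarrow> sat_query M v Q \<longleftrightarrow> sat_query M w Q"
  using sat_lit_cong[of _ v w M] by (induction Q) auto

text \<open>A renaming has to permute all variables, so mapping \<open>W\<close> injectively to
  fresh variables is not enough. Instead \<open>W\<close> is exchanged with an equally large set
  \<open>W'\<close> of variables outside \<open>V\<close> and \<open>W\<close>.\<close>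

lemma renaming_apart:
  fixes W V :: "'v :: infinite set"
  assumes "finite W" "finite V"
  obtains \<pi> :: "'v \<Rightarrow> 'v" where "bij \<pi>" "\<pi> ` W \<inter> V = {}"
proof -
  have "infinite (- (V \<union> W))"
    using assms infinite_UNIV by (metis finite_UnI finite_compl)
  then obtain W' where W': "finite W'" "card W' = card W" "W' \<subseteq> - (V \<union> W)"
    using infinite_arbitrarily_large by metis
  then obtain h where h: "bij_betw h W W'"
    using assms finite_same_card_bij by metis
  \<comment> \<open>Swaps \<open>W\<close> and \<open>W'\<close> and fixes all other variables;
    bijective because it is an involution.\<close>
  define \<pi> where "\<pi> x = (if x \<in> W then h x else if x \<in> W' then the_inv_into W h x else x)" for x
  have h_in: "h x \<in> W'" if "x \<in> W" for x
    using h that by (auto simp: bij_betw_def)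
  have inv_in: "the_inv_into W h x \<in> W" "h (the_inv_into W h x) = x" if "x \<in> W'" for x
    using h that the_inv_into_into[of h W x W] f_the_inv_into_f[of h W x]
    by (auto simp: bij_betw_def)
  have "\<pi> (\<pi> x) = x" for x
    using h_in inv_in W'(3) h the_inv_into_f_f[of h W x]
    by (auto simp: \<pi>_def bij_betw_def)
  then have "bij \<pi>" by (metis involuntory_imp_bij)
  moreover have "\<pi> ` W \<inter> V = {}"
    using h_in W'(3) by (auto simp: \<pi>_def)
  ultimately show thesis by (rule that)
qed

section \<open>Unification in models of the free equality axioms\<close>

abbreviation vars_eqs :: "(('f, 'v) trm \<times> ('f, 'v) trm) list \<Rightarrow> 'v set" where
  "vars_eqs E \<equiv> (\<Union>(s, t) \<in> set E. vars_term s \<union> vars_term t)"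

abbreviation size_eqs :: "(('f, 'v) trm \<times> ('f, 'v) trm) list \<Rightarrow> nat" where
  "size_eqs E \<equiv> (\<Sum>(s, t) \<leftarrow> E. size s + size t)"

definition solves :: "('p, 'f, 'd) interp \<Rightarrow> ('v \<Rightarrow> 'd) \<Rightarrow> (('f, 'v) trm \<times> ('f, 'v) trm) list \<Rightarrow> bool" where
  "solves M v E \<longleftrightarrow> (\<forall>(s, t) \<in> set E. eval M v s = eval M v t)"

definition unifies :: "('f, 'v) subst \<Rightarrow> (('f, 'v) trm \<times> ('f, 'v) trm) list \<Rightarrow> bool" where
  "unifies \<sigma> E \<longleftrightarrow> (\<forall>(s, t) \<in> set E. subst_term \<sigma> s = subst_term \<sigma> t)"

text \<open>The last conjunct is the analogue for the valuations in \<open>M\<close> of the preceding one for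
  unifiers; it is what allows a model of the completion to follow a resolution step.\<close>

definition solved_form ::
  "('p, 'f) signature \<Rightarrow> ('p, 'f, 'd) interp \<Rightarrow> (('f, 'v) trm \<times> ('f, 'v) trm) list \<Rightarrow> ('f, 'v) subst \<Rightarrow> bool" where
  "solved_form L M E \<theta> \<longleftrightarrow> wf_subst L \<theta> \<and> unifies \<theta> E \<and>
     (\<forall>\<sigma>. unifies \<sigma> E \<longrightarrow> (\<forall>x. \<sigma> x = subst_term \<sigma> (\<theta> x))) \<and>
     (\<forall>v. solves M v E \<longrightarrow> (\<forall>x. v x = eval M v (\<theta> x)))"

lemma solves_simps [simp]:
  "solves M v []"
  "solves M v ((s, t) # E) \<longleftrightarrow> eval M v s = eval M v t \<and> solves M v E"
  "solves M v (E @ E') \<longleftrightarrow> solves M v E \<and> solves M v E'"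
  by (auto simp: solves_def)

lemma unifies_simps [simp]:
  "unifies \<sigma> []"
  "unifies \<sigma> ((s, t) # E) \<longleftrightarrow> subst_term \<sigma> s = subst_term \<sigma> t \<and> unifies \<sigma> E"
  "unifies \<sigma> (E @ E') \<longleftrightarrow> unifies \<sigma> E \<and> unifies \<sigma> E'"
  by (auto simp: unifies_def)

lemma solved_formD:
  assumes "solved_form L M E \<theta>"
  shows "wf_subst L \<theta>" "unifies \<theta> E"
    "unifies \<sigma> E \<Longrightarrow> subst_term \<sigma> (\<theta> x) = \<sigma> x"
    "solves M v E \<Longrightarrow> eval M v (\<theta> x) = v x"
  by (insert assms, unfold solved_form_def) (blast, blast, (rule sym, blast)+)

lemma solved_form_cong:
  assumes "\<And>\<sigma>. unifies \<sigma> E \<longleftrightarrow> unifies \<sigma> E'" "\<And>v. solves M v E \<longleftrightarrow> solves M v E'"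
  shows "solved_form L M E \<theta> \<longleftrightarrow> solved_form L M E' \<theta>"
  by (simp add: solved_form_def assms)

lemma solves_zip:
  "length ss = length ts \<Longrightarrow> solves M v (zip ss ts) \<longleftrightarrow> map (eval M v) ss = map (eval M v) ts"
  by (induction ss ts rule: list_induct2) auto

lemma unifies_zip:
  "length ss = length ts \<Longrightarrow>
     unifies \<sigma> (zip ss ts) \<longleftrightarrow> map (subst_term \<sigma>) ss = map (subst_term \<sigma>) ts"
  by (induction ss ts rule: list_induct2) auto

lemma size_eqs_zip: "size_eqs (zip ss ts) \<le> size_list size ss + size_list size ts"
  by (induction ss ts rule: list_induct2') auto

lemma vars_eqs_zip: "vars_eqs (zip ss ts) \<subseteq> vars_term (Fun f ss) \<union> vars_term (Fun g ts)"
  by (induction ss ts rule: list_induct2') auto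

text \<open>The variable elimination rule of unification. A unifier of \<open>Var x\<close> and
  \<open>t\<close>, and likewise a valuation giving them the same value, is unchanged by
  precomposition with \<open>\<theta>\<^sub>1\<close>. It therefore also solves the instantiated
  equations, to which \<open>\<theta>\<close> applies.\<close>

lemma solved_form_elim_var:
  fixes x :: 'v and t :: "('f, 'v) trm"
  defines "\<theta>\<^sub>1 \<equiv> Var(x := t)"
  assumes x: "x \<notin> vars_term t" and t: "wf_term L t"
    and \<theta>: "solved_form L M (map (map_prod (subst_term \<theta>\<^sub>1) (subst_term \<theta>\<^sub>1)) E) \<theta>"
  shows "solved_form L M ((Var x, t) # E) (\<lambda>y. subst_term \<theta> (\<theta>\<^sub>1 y))"
proof -
  let ?E = "map (map_prod (subst_term \<theta>\<^sub>1) (subst_term \<theta>\<^sub>1)) E"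
  have t\<theta>\<^sub>1: "subst_term \<theta>\<^sub>1 t = t"
  proof -
    have "subst_term \<theta>\<^sub>1 t = subst_term Var t"
      by (rule subst_term_cong) (use x in \<open>auto simp: \<theta>\<^sub>1_def\<close>)
    then show ?thesis by simp
  qed
  have "wf_subst L (\<lambda>y. subst_term \<theta> (\<theta>\<^sub>1 y))"
    using t solved_formD(1)[OF \<theta>] by (intro wf_subst_comp) (auto simp: \<theta>\<^sub>1_def wf_subst_def)
  moreover have "unifies (\<lambda>y. subst_term \<theta> (\<theta>\<^sub>1 y)) ((Var x, t) # E)"
  proof -
    have "subst_term \<theta> (\<theta>\<^sub>1 x) = subst_term (\<lambda>y. subst_term \<theta> (\<theta>\<^sub>1 y)) t"
      by (metis \<theta>\<^sub>1_def fun_upd_same subst_term_subst_term t\<theta>\<^sub>1)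
    moreover have "unifies (\<lambda>y. subst_term \<theta> (\<theta>\<^sub>1 y)) E"
      using solved_formD(2)[OF \<theta>] by (fastforce simp: unifies_def simp flip: subst_term_subst_term)
    ultimately show ?thesis by simp
  qed
  moreover have "\<sigma> y = subst_term \<sigma> (subst_term \<theta> (\<theta>\<^sub>1 y))" if "unifies \<sigma> ((Var x, t) # E)" for \<sigma> y
  proof -
    have \<sigma>: "(\<lambda>y. subst_term \<sigma> (\<theta>\<^sub>1 y)) = \<sigma>"
      using that by (auto simp: \<theta>\<^sub>1_def)
    have "unifies \<sigma> ?E"
      using that by (fastforce simp: unifies_def subst_term_subst_term \<sigma>)
    then have \<sigma>\<theta>: "(\<lambda>y. subst_term \<sigma> (\<theta> y)) = \<sigma>"
      using solved_formD(3)[OF \<theta>] by (intro ext)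
    show ?thesis
      unfolding subst_term_subst_term \<sigma>\<theta> using \<sigma> by (rule fun_cong[OF sym])
  qed
  moreover have "v y = eval M v (subst_term \<theta> (\<theta>\<^sub>1 y))" if "solves M v ((Var x, t) # E)" for v y
  proof -
    have v: "(\<lambda>y. eval M v (\<theta>\<^sub>1 y)) = v"
      using that by (auto simp: \<theta>\<^sub>1_def)
    have "solves M v ?E"
      using that by (fastforce simp: solves_def eval_subst v)
    then have v\<theta>: "(\<lambda>y. eval M v (\<theta> y)) = v"
      using solved_formD(4)[OF \<theta>] by (intro ext)
    show ?thesis
      unfolding eval_subst v\<theta> using v by (rule fun_cong[OF sym])
  qed
  ultimately show ?thesis unfolding solved_form_def by blast
qed

text \<open>Elimination makes \<open>x\<close> disappear and adds only variables of
  \<open>t\<close>, which are already counted on the right. This makes the unification algorithm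
  terminate.\<close>

lemma vars_eqs_elim_var:
  assumes "x \<notin> vars_term t"
  shows "card (vars_eqs (map (map_prod (subst_term (Var(x := t))) (subst_term (Var(x := t)))) E))
       < card (vars_eqs ((Var x, t) # E))"
proof (rule psubset_card_mono)
  have "vars_term (subst_term (Var(x := t)) s) \<subseteq> vars_term s \<union> vars_term t - {x}" for s
    using assms by (auto simp: vars_term_subst split: if_splits)
  then have "vars_eqs (map (map_prod (subst_term (Var(x := t))) (subst_term (Var(x := t)))) E)
      \<subseteq> vars_eqs ((Var x, t) # E) - {x}"
    by fastforce
  moreover have "x \<in> vars_eqs ((Var x, t) # E)"
    by simp
  ultimately show "vars_eqs (map (map_prod (subst_term (Var(x := t))) (subst_term (Var(x := t)))) E)
      \<subset> vars_eqs ((Var x, t) # E)"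
    by blast
qed auto

lemma free_equality_fun_interp:
  assumes "free_equality TYPE('v) L M" "length ds = fun_arity L f" "length es = fun_arity L g"
    and "fun_interp M f ds = fun_interp M g es"
  shows "f = g \<and> ds = es"
proof (cases "f = g")
  case True
  then show ?thesis
    using assms unfolding free_equality_def by blast
next
  case False
  then show ?thesis
    using assms unfolding free_equality_def by blast
qed

lemma free_equality_occurs:
  fixes x :: 'v and t :: "('f, 'v) trm"
  assumes "free_equality TYPE('v) L M" "wf_term L t" "v x = eval M v t" "t \<noteq> Var x"
  shows "x \<notin> vars_term t"
proof
  assume "x \<in> vars_term t"
  then have "eval M v t \<noteq> v x"
    using assms(1,2,4) unfolding free_equality_def by blast
  with assms(3) show False by simp
qed

text \<open>The unification algorithm, run on equations that hold in \<open>M\<close>: clash and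
  occurs-check failures would contradict the free equality axioms, so the run succeeds. Elimination
  lowers the number of variables; deletion and decomposition lower the size without adding
  variables.\<close>

lemma solvable_imp_solved_form:
  fixes E :: "(('f, 'v) trm \<times> ('f, 'v) trm) list"
  assumes M: "free_equality TYPE('v) L M"
  shows "(\<And>s t. (s, t) \<in> set E \<Longrightarrow> wf_term L s \<and> wf_term L t) \<Longrightarrow> solves M v E \<Longrightarrow>
    \<exists>\<theta>. solved_form L M E \<theta>"
proof (induction E rule: wf_induct_rule[OF wf_measures[of "[\<lambda>E. card (vars_eqs E), size_eqs]"]])
  case (1 E)
  \<comment> \<open>Stated for a list with as many variables as \<open>E\<close>, not for
    \<open>E\<close> itself, so that it also covers an equation with the variable on the right after
    its sides are swapped.\<close>
  have elim: "\<exists>\<theta>. solved_form L M ((Var x, t) # E') \<theta>"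
    if E': "card (vars_eqs ((Var x, t) # E')) = card (vars_eqs E)" "t \<noteq> Var x" "wf_term L t"
      "\<forall>(s, t) \<in> set E'. wf_term L s \<and> wf_term L t" "solves M v ((Var x, t) # E')"
    for x t E'
  proof -
    let ?\<theta> = "Var(x := t)"
    let ?E = "map (map_prod (subst_term ?\<theta>) (subst_term ?\<theta>)) E'"
    have x: "x \<notin> vars_term t"
      using free_equality_occurs[OF M E'(3), of v x] E'(2,5) by simp
    have "(\<lambda>y. eval M v (?\<theta> y)) = v"
      using E' by auto
    then have v: "eval M v (subst_term ?\<theta> u) = eval M v u" for u
      by (simp only: eval_subst)
    have "wf_subst L ?\<theta>"
      using E' by (simp add: wf_subst_def)
    then have "wf_term L s \<and> wf_term L u" if "(s, u) \<in> set ?E" for s u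
      using that E'(4) by (auto intro!: wf_subst_term)
    moreover have "solves M v ?E"
      using E'(5) by (fastforce simp: solves_def v)
    moreover have "(?E, E) \<in> measures [\<lambda>E. card (vars_eqs E), size_eqs]"
      using vars_eqs_elim_var[OF x, of E'] E'(1) by simp
    ultimately obtain \<theta> where "solved_form L M ?E \<theta>"
      using 1(1) by blast
    from solved_form_elim_var[OF x E'(3) this] show ?thesis by blast
  qed
  show ?case
  proof (cases E)
    case Nil
    then show ?thesis by (auto simp: solved_form_def intro: exI[of _ Var])
  next
    case (Cons e E')
    obtain s t where e: "e = (s, t)" by fastforce
    have wf: "wf_term L s" "wf_term L t" "\<forall>(s, t) \<in> set E'. wf_term L s \<and> wf_term L t"
      using 1(2) Cons e by auto
    consider (triv) x where "s = Var x" "t = Var x"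
      | (left) x where "s = Var x" "t \<noteq> Var x"
      | (right) x where "t = Var x" "s \<noteq> Var x"
      | (decomp) f ss g ts where "s = Fun f ss" "t = Fun g ts"
      by (cases s; cases t) auto
    then show ?thesis
    proof cases
      case triv
      have "card (vars_eqs E') \<le> card (vars_eqs E)"
        unfolding Cons e by (intro card_mono) auto
      then have "(E', E) \<in> measures [\<lambda>E. card (vars_eqs E), size_eqs]"
        using Cons e triv by auto
      then obtain \<theta> where "solved_form L M E' \<theta>"
        using 1(1)[of E'] 1(3) wf(3) unfolding Cons e by auto
      then show ?thesis
        using Cons e triv by (auto simp: solved_form_def)
    next
      case left
      then show ?thesis
        using elim[of x t E'] 1(3) wf unfolding Cons e by simp
    next
      case right
      have "card (vars_eqs ((Var x, s) # E')) = card (vars_eqs E)"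
        using Cons e right by (simp add: Un_commute)
      then have "\<exists>\<theta>. solved_form L M ((Var x, s) # E') \<theta>"
        using elim[of x s E'] 1(3) wf right unfolding Cons e by simp
      moreover have "solved_form L M ((Var x, s) # E') \<theta> \<longleftrightarrow> solved_form L M E \<theta>" for \<theta>
        unfolding Cons e right by (rule solved_form_cong) auto
      ultimately show ?thesis by blast
    next
      case decomp
      have len: "length ss = fun_arity L f" "length ts = fun_arity L g"
        using wf decomp by auto
      have eq: "fun_interp M f (map (eval M w) ss) = fun_interp M g (map (eval M w) ts)"
        if "solves M w E" for w
        using that by (simp add: Cons e decomp)
      \<comment> \<open>No clash: different function symbols have disjoint ranges in
        \<open>M\<close>. Injectivity then gives the equality of the arguments below.\<close>
      have [simp]: "g = f"
        using free_equality_fun_interp[OF M _ _ eq[OF 1(3)]] len by simp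
      have len': "length ss = length ts"
        using len by simp
      have args: "map (eval M w) ss = map (eval M w) ts" if "solves M w E" for w
        using free_equality_fun_interp[OF M _ _ eq[OF that]] len by simp
      let ?E = "zip ss ts @ E'"
      have solves: "solves M w ?E \<longleftrightarrow> solves M w E" for w
      proof
        assume "solves M w E"
        then show "solves M w ?E"
          using args by (simp add: Cons e solves_zip[OF len'])
      next
        assume "solves M w ?E"
        then have "map (eval M w) ss = map (eval M w) ts" "solves M w E'"
          by (simp_all add: solves_zip[OF len'])
        then show "solves M w E"
          unfolding Cons e decomp by (simp del: map_eq_conv)
      qed
      have "vars_eqs ?E \<subseteq> vars_eqs E"
        using vars_eqs_zip[of ss ts] by (auto simp: Cons e decomp)
      then have "card (vars_eqs ?E) \<le> card (vars_eqs E)"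
        by (intro card_mono) auto
      moreover have "size_eqs ?E < size_eqs E"
        using size_eqs_zip[of ss ts] by (simp add: Cons e decomp)
      ultimately have "(?E, E) \<in> measures [\<lambda>E. card (vars_eqs E), size_eqs]"
        by auto
      moreover have "wf_term L s' \<and> wf_term L t'" if "(s', t') \<in> set ?E" for s' t'
        using that wf decomp by (auto dest: set_zip_leftD set_zip_rightD)
      moreover have "solves M v ?E"
        using 1(3) solves by blast
      ultimately obtain \<theta> where "solved_form L M ?E \<theta>"
        using 1(1) by blast
      moreover have "solved_form L M ?E \<theta> \<longleftrightarrow> solved_form L M E \<theta>"
        by (rule solved_form_cong) (use solves in \<open>auto simp: Cons e decomp unifies_zip[OF len']\<close>)
      ultimately show ?thesis by blast
    qed
  qed
qed

text \<open>Turns a semantic solution into a syntactic mgu through which it factors, so the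
  valuation \<open>v\<close> still satisfies whatever it satisfied once the mgu has been
  applied.\<close>

lemma mgu_of_solvable:
  fixes A H :: "('p, 'f, 'v) atom"
  assumes M: "free_equality TYPE('v) L M"
    and wf: "wf_atom L A" "wf_atom L H" and rel: "rel_of A = rel_of H"
    and eq: "map (eval M v) (args_of A) = map (eval M v) (args_of H)"
  obtains \<theta> where "is_mgu L \<theta> A H" "\<And>x. eval M v (\<theta> x) = v x"
proof -
  let ?E = "zip (args_of A) (args_of H)"
  have len: "length (args_of A) = length (args_of H)"
    using wf rel by (simp add: wf_atom_def)
  have "\<exists>\<theta>. solved_form L M ?E \<theta>"
  proof (rule solvable_imp_solved_form[OF M])
    show "wf_term L s \<and> wf_term L t" if "(s, t) \<in> set ?E" for s t
      using that wf by (auto simp: wf_atom_def dest: set_zip_leftD set_zip_rightD)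
    show "solves M v ?E"
      using eq len by (simp add: solves_zip)
  qed
  then obtain \<theta> where \<theta>: "solved_form L M ?E \<theta>" ..
  have uni: "unifies \<sigma> ?E \<longleftrightarrow> subst_atom \<sigma> A = subst_atom \<sigma> H" for \<sigma>
    using rel by (cases A; cases H) (use len in \<open>simp add: unifies_zip\<close>)
  have "is_mgu L \<theta> A H"
    unfolding is_mgu_def
  proof (intro conjI allI impI)
    fix \<sigma> :: "('f, 'v) subst"
    assume \<sigma>: "wf_subst L \<sigma> \<and> subst_atom \<sigma> A = subst_atom \<sigma> H"
    then have "\<sigma> x = subst_term \<sigma> (\<theta> x)" for x
      using solved_formD(3)[OF \<theta>, symmetric] unfolding uni by blast
    \<comment> \<open>The witness for \<open>\<delta>\<close> is \<open>\<sigma>\<close> itself,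
      since a solved form is absorbed by every unifier.\<close>
    with \<sigma> show "\<exists>\<delta>. wf_subst L \<delta> \<and> (\<forall>x. \<sigma> x = subst_term \<delta> (\<theta> x))"
      by blast
  qed (use solved_formD(1,2)[OF \<theta>] in \<open>simp_all add: uni\<close>)
  moreover have "eval M v (\<theta> x) = v x" for x
    by (rule solved_formD(4)[OF \<theta>]) (use eq len in \<open>simp add: solves_zip\<close>)
  ultimately show thesis by (rule that)
qed

section \<open>Soundness with respect to the complete model\<close>

lemma pos_resolventE:
  assumes "pos_resolvent L P A Ls Q'"
  obtains H B \<rho> \<theta> where "(H, B) \<in> P" "renaming \<rho>"
    "vars_clause (subst_clause \<rho> (H, B)) \<inter> vars_query (Pos A # Ls) = {}"
    "is_mgu L \<theta> A (subst_atom \<rho> H)"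
    "Q' = subst_query \<theta> (subst_query \<rho> B @ Ls)"
proof -
  from assms obtain C \<rho> H B \<theta> where "C \<in> P" "renaming \<rho>" "subst_clause \<rho> C = (H, B)"
    "vars_clause (H, B) \<inter> vars_query (Pos A # Ls) = {}" "is_mgu L \<theta> A H"
    "Q' = subst_query \<theta> (B @ Ls)"
    unfolding pos_resolvent_def by blast
  then show thesis
    by (cases C) (use that in \<open>auto simp del: vars_clause.simps\<close>)
qed

lemma is_mguD:
  assumes "is_mgu L \<theta> A H"
  shows "wf_subst L \<theta>" "subst_atom \<theta> A = subst_atom \<theta> H"
  using assms unfolding is_mgu_def by blast+

lemma is_mgu_rel_of: "is_mgu L \<theta> A H \<Longrightarrow> rel_of A = rel_of H"
  using is_mguD(2) rel_of_subst_atom by metis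

lemma rels_subst_query:
  "(\<lambda>l. rel_of (atom_of l)) ` set (subst_query \<theta> Q) = (\<lambda>l. rel_of (atom_of l)) ` set Q"
  by (simp add: subst_query_def image_image)

lemma neg_rels_star_body:
  assumes "(H, B) \<in> P" "rel_of H \<in> neg_rels_star P" "l \<in> set B"
  shows "rel_of (atom_of l) \<in> neg_rels_star P"
proof -
  have "refers_to P (rel_of H) (rel_of (atom_of l))"
    using assms unfolding refers_to_def by blast
  with assms(2) show ?thesis
    unfolding neg_rels_star_def depends_on_def by (blast intro: rtranclp.rtrancl_into_rtrancl)
qed

text \<open>Substitutions keep signs and relations, so the literal stems from a negative literal of
  the clause.\<close>

lemma neg_rels_subst_query:
  assumes "Neg A \<in> set (subst_query \<theta> (subst_query \<rho> B))" "(H, B) \<in> P"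
  shows "rel_of A \<in> neg_rels P"
proof -
  obtain l where l: "l \<in> set B" "Neg A = subst_lit \<theta> (subst_lit \<rho> l)"
    using assms(1) by (auto simp: subst_query_def)
  from l(2) obtain A' where "l = Neg A'"
    by (cases l) auto
  with l(2) have "rel_of A = rel_of A'"
    by simp
  with \<open>l = Neg A'\<close> show ?thesis
    using assms(2) l(1) unfolding neg_rels_def by blast
qed

lemma neg_rels_subset_star: "neg_rels P \<subseteq> neg_rels_star P"
  unfolding neg_rels_star_def depends_on_def by blast

locale program_with_complete_model =
  fixes L :: "('p, 'f) signature"
    and P :: "('p, 'f, 'v :: infinite) prog"
    and M :: "('p, 'f, 'd) interp"
  assumes program: "program L P"
    and complete: "complete_model L P M"
begin

lemma wf_clause: "(H, B) \<in> P \<Longrightarrow> wf_atom L H \<and> wf_query L B"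
  using program unfolding program_def by blast

lemma model: "(H, B) \<in> P \<Longrightarrow> sat_query M v B \<Longrightarrow> sat_atom M v H"
  using complete unfolding complete_model_def is_model_def by blast

lemma free_equality: "free_equality TYPE('v) L M"
  using complete unfolding complete_model_def is_model_of_completion_def by blast

lemma completion:
  assumes "p \<in> neg_rels_star P" "length ds = rel_arity L p" "rel_interp M p ds"
  obtains ts B v where "(Atom p ts, B) \<in> P" "ds = map (eval M v) ts" "sat_query M v B"
proof -
  have "\<exists>ts B v. (Atom p ts, B) \<in> neg_part P \<and> ds = map (eval M v) ts \<and> sat_query M v B"
    using complete assms unfolding complete_model_def is_model_of_completion_def by blast
  then show thesis
    using that unfolding neg_part_def by blast
qed

lemma wf_pos_resolvent:
  assumes "pos_resolvent L P A Ls Q'" "wf_query L (Pos A # Ls)"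
  shows "wf_query L Q'"
  using assms(1)
proof (cases rule: pos_resolventE)
  case (1 H B \<rho> \<theta>)
  then show ?thesis
    using assms(2) wf_clause[of H B] is_mguD(1)[of L \<theta>] wf_subst_renaming[of \<rho> L]
    by (auto intro!: wf_subst_query)
qed

lemma wf_ldnf_step: "ldnf_step L P Q Q' \<Longrightarrow> wf_query L Q \<Longrightarrow> wf_query L Q'"
  by (auto simp: ldnf_step.simps resolvent.simps intro: wf_pos_resolvent)

text \<open>Evaluating \<open>\<theta>\<close> under the given valuation yields one that identifies
  \<open>A\<close> with the clause head, and the head is true there by \<open>model\<close>.\<close>

lemma pos_resolvent_sound:
  assumes "pos_resolvent L P A Ls Q'" "sat_query M v Q'"
  shows "\<exists>v. sat_query M v (Pos A # Ls)"
  using assms(1)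
proof (cases rule: pos_resolventE)
  case (1 H B \<rho> \<theta>)
  let ?v = "\<lambda>x. eval M v (\<theta> x)"
  have "sat_query M ?v (subst_query \<rho> B)" "sat_query M ?v Ls"
    using assms(2) 1 by (simp_all add: sat_query_subst)
  moreover from this have "sat_atom M ?v (subst_atom \<rho> H)"
    using model[OF 1(1)] by (simp add: sat_query_subst sat_atom_subst)
  moreover have "sat_atom M ?v A \<longleftrightarrow> sat_atom M ?v (subst_atom \<rho> H)"
    using is_mguD(2)[OF 1(4)] by (metis sat_atom_subst)
  ultimately show ?thesis by auto
qed

text \<open>The only-if half of the completion supplies a clause whose body is true and whose head
  has the same values as \<open>A\<close>. After renaming apart, a single valuation solves the
  equation of \<open>A\<close> and the head, hence factors through an mgu and satisfies the
  resolvent.\<close>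

lemma pos_resolvent_complete:
  assumes "sat_query M v (Pos A # Ls)" "wf_query L (Pos A # Ls)" "rel_of A \<in> neg_rels_star P"
  obtains Q' w where "pos_resolvent L P A Ls Q'" "sat_query M w Q'"
proof -
  obtain p ts where A: "A = Atom p ts" by (cases A)
  have "rel_interp M p (map (eval M v) ts)" "length (map (eval M v) ts) = rel_arity L p"
    using assms A by (simp_all add: wf_atom_def)
  then obtain us B u where B: "(Atom p us, B) \<in> P" "map (eval M v) ts = map (eval M u) us"
    "sat_query M u B"
    using completion assms(3) A by (metis atom.sel(1))
  obtain \<pi> :: "'v \<Rightarrow> 'v" where \<pi>: "bij \<pi>"
    "\<pi> ` vars_clause (Atom p us, B) \<inter> vars_query (Pos A # Ls) = {}"
    using renaming_apart finite_vars_clause finite_vars_query by metis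
  define \<rho> :: "('f, 'v) subst" where "\<rho> x = Var (\<pi> x)" for x
  have \<rho>: "renaming \<rho>"
    using \<pi>(1) by (auto simp: renaming_def \<rho>_def fun_eq_iff intro: exI[of _ \<pi>])
  have apart: "vars_clause (subst_clause \<rho> (Atom p us, B)) \<inter> vars_query (Pos A # Ls) = {}"
  proof -
    have "vars_clause (subst_clause \<rho> (Atom p us, B)) = \<pi> ` vars_clause (Atom p us, B)"
      unfolding subst_clause.simps vars_clause.simps vars_atom_subst vars_query_subst
      by (auto simp: \<rho>_def)
    with \<pi>(2) show ?thesis by simp
  qed
  \<comment> \<open>\<open>v\<close> on the variables of the query, and \<open>u\<close> transported
    along \<open>\<pi>\<close> elsewhere; disjointness of the variables makes both parts
    survive.\<close>
  define w where "w x = (if x \<in> vars_query (Pos A # Ls) then v x else u (inv \<pi> x))" for x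
  have wv: "w x = v x" if "x \<in> vars_query (Pos A # Ls)" for x
    using that by (simp add: w_def)
  have wu: "w (\<pi> x) = u x" if "x \<in> vars_clause (Atom p us, B)" for x
  proof -
    have "\<pi> x \<notin> vars_query (Pos A # Ls)"
      using \<pi>(2) that by blast
    then show ?thesis
      using \<pi>(1) by (simp add: w_def bij_is_inj)
  qed
  have "map (eval M w) (args_of A) = map (eval M v) ts"
    using A by (auto intro!: eval_cong wv simp: vars_atom_def)
  moreover have "map (eval M w) (args_of (subst_atom \<rho> (Atom p us))) = map (eval M u) us"
    by (auto simp: eval_subst \<rho>_def vars_atom_def intro!: eval_cong wu)
  moreover have "wf_atom L A" "wf_atom L (subst_atom \<rho> (Atom p us))"
    using assms(2) wf_clause[OF B(1)] \<rho> by (auto intro!: wf_subst_atom wf_subst_renaming simp del: subst_atom.simps)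
  moreover have "rel_of A = rel_of (subst_atom \<rho> (Atom p us))"
    using A by simp
  ultimately obtain \<theta> where \<theta>: "is_mgu L \<theta> A (subst_atom \<rho> (Atom p us))"
      "\<And>x. eval M w (\<theta> x) = w x"
    using mgu_of_solvable[OF free_equality] B(2) by metis
  have "sat_query M w (subst_query \<rho> B)"
  proof -
    have "sat_query M (\<lambda>x. eval M w (\<rho> x)) B \<longleftrightarrow> sat_query M u B"
      by (rule sat_query_cong) (simp add: \<rho>_def wu)
    with B(3) show ?thesis by (simp add: sat_query_subst)
  qed
  moreover have "sat_query M w Ls"
    using assms(1) sat_query_cong[of Ls w v M] wv by simp
  ultimately have "sat_query M w (subst_query \<theta> (subst_query \<rho> B @ Ls))"
    using \<theta>(2) by (simp add: sat_query_subst)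
  moreover have "pos_resolvent L P A Ls (subst_query \<theta> (subst_query \<rho> B @ Ls))"
    unfolding pos_resolvent_def
    using B(1) \<rho> apart \<theta>(1) subst_clause.simps[of \<rho> "Atom p us" B] by metis
  ultimately show thesis
    using that by blast
qed

text \<open>The relations in \<open>neg_rels_star P\<close> are closed under dependence, so the
  completion stays applicable along the branches of a subsidiary tree.\<close>

lemma pos_resolvent_rels:
  assumes "pos_resolvent L P A Ls Q'"
    and "\<forall>l \<in> set (Pos A # Ls). rel_of (atom_of l) \<in> neg_rels_star P"
  shows "\<forall>l \<in> set Q'. rel_of (atom_of l) \<in> neg_rels_star P"
  using assms(1)
proof (cases rule: pos_resolventE)
  case (1 H B \<rho> \<theta>)
  have "rel_of H \<in> neg_rels_star P"
    using assms(2) is_mgu_rel_of[OF 1(4)] by simp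
  then have "(\<lambda>l. rel_of (atom_of l)) ` set (B @ Ls) \<subseteq> neg_rels_star P"
    using assms(2) neg_rels_star_body[OF 1(1)] by auto
  then have "(\<lambda>l. rel_of (atom_of l)) ` set Q' \<subseteq> neg_rels_star P"
    using 1(5) rels_subst_query by (metis image_Un set_append)
  then show ?thesis by blast
qed

lemma sat_atom_ground: "vars_atom A = {} \<Longrightarrow> sat_atom M v A \<Longrightarrow> sat_atom M w A"
  using sat_atom_cong[of A v w M] by blast

text \<open>Success and failure must be treated together, because the subsidiary trees exchange
  their roles.  A floundered branch says nothing about the truth of the query.\<close>

lemma ldnf_tree_sound:
  assumes "ldnf_tree L P Q S" "wf_query L Q" "\<forall>l \<in> set Q. rel_of (atom_of l) \<in> neg_rels_star P"
  shows "(Successful \<in> S \<longrightarrow> (\<exists>v. sat_query M v Q)) \<and>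
    ((\<exists>v. sat_query M v Q) \<longrightarrow> \<not> S \<subseteq> {Failed})"
  using assms
proof (induction rule: ldnf_tree.induct)
  case (no_resolvent A Ls)
  then show ?case
    using pos_resolvent_complete[of _ A Ls] by auto
next
  case (resolvents A Ls F)
  have IH: "(Successful \<in> F Q' \<longrightarrow> (\<exists>v. sat_query M v Q')) \<and>
      ((\<exists>v. sat_query M v Q') \<longrightarrow> \<not> F Q' \<subseteq> {Failed})" if "pos_resolvent L P A Ls Q'" for Q'
    using resolvents(3)[OF that wf_pos_resolvent[OF that resolvents(4)]
        pos_resolvent_rels[OF that resolvents(5)]] .
  show ?case
  proof (intro conjI impI)
    assume "Successful \<in> (\<Union>Q' \<in> Collect (pos_resolvent L P A Ls). F Q')"
    then show "\<exists>v. sat_query M v (Pos A # Ls)"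
      using IH pos_resolvent_sound by blast
  next
    assume "\<exists>v. sat_query M v (Pos A # Ls)"
    then obtain Q' w where "pos_resolvent L P A Ls Q'" "sat_query M w Q'"
      using pos_resolvent_complete[of _ A Ls] resolvents(4,5) by auto
    \<comment> \<open>Being not contained in \<open>{Failed}\<close> passes from the outcomes of one
      resolvent to the union.\<close>
    with IH show "\<not> (\<Union>Q' \<in> Collect (pos_resolvent L P A Ls). F Q') \<subseteq> {Failed}"
      by blast
  qed
next
  case (subsidiary_failed A Ls S)
  then have "\<not> sat_atom M v A" for v
    by auto
  with subsidiary_failed show ?case
    by auto
next
  case (subsidiary_successful A T Ls)
  \<comment> \<open>Success provides only one valuation; groundness of \<open>A\<close> extends it
    to all.\<close>
  then have "sat_atom M v A" for v
    using sat_atom_ground[of A _ v] by auto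
  then show ?case
    by simp
qed auto

lemma finitely_failed_sound:
  assumes "finitely_failed L P [Pos A]" "wf_atom L A" "rel_of A \<in> neg_rels_star P"
  shows "\<not> sat_atom M v A"
  using assms ldnf_tree_sound[of "[Pos A]" "{Failed}"] unfolding finitely_failed_def by auto

end

section \<open>Computed answers of the initial part of a query\<close>

text \<open>\<open>answer L P B T \<sigma>\<close>: in a derivation of \<open>B @ T\<close> the literals of \<open>B\<close> are
  resolved completely, with composed substitution \<open>\<sigma>\<close>, and \<open>T\<close> has not been selected yet.
  \<open>T\<close> is recorded because the clauses are renamed apart from the whole query.\<close>

inductive answer ::
  "('p, 'f) signature \<Rightarrow> ('p, 'f, 'v) prog \<Rightarrow> ('p, 'f, 'v) query \<Rightarrow> ('p, 'f, 'v) query \<Rightarrow>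
   ('f, 'v) subst \<Rightarrow> bool"
  for L P where
  Nil: "answer L P [] T Var"
| Pos: "(H, B) \<in> P \<Longrightarrow> renaming \<rho> \<Longrightarrow>
     vars_clause (subst_clause \<rho> (H, B)) \<inter> vars_query (Pos A # Bs @ T) = {} \<Longrightarrow>
     is_mgu L \<theta> A (subst_atom \<rho> H) \<Longrightarrow>
     answer L P (subst_query \<theta> (subst_query \<rho> B @ Bs)) (subst_query \<theta> T) \<sigma> \<Longrightarrow>
     answer L P (Pos A # Bs) T (\<lambda>x. subst_term \<sigma> (\<theta> x))"
| Neg: "vars_atom A = {} \<Longrightarrow> finitely_failed L P [Pos A] \<Longrightarrow> answer L P Bs T \<sigma> \<Longrightarrow>
     answer L P (Neg A # Bs) T \<sigma>"

lemma pos_resolventI: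
  assumes "(H, B) \<in> P" "renaming \<rho>"
    and "vars_clause (subst_clause \<rho> (H, B)) \<inter> vars_query (Pos A # Ls) = {}"
    and "is_mgu L \<theta> A (subst_atom \<rho> H)"
  shows "pos_resolvent L P A Ls (subst_query \<theta> (subst_query \<rho> B @ Ls))"
  unfolding pos_resolvent_def using assms subst_clause.simps[of \<rho> H B] by metis

lemma answer_wf_subst: "answer L P B T \<sigma> \<Longrightarrow> wf_subst L \<sigma>"
  by (induction rule: answer.induct) (auto intro!: wf_subst_comp dest: is_mguD(1))

text \<open>An answer is a stretch of a single branch, without steps into subsidiary trees. Hence
  properties inherited by descendants reach the instantiated tail.\<close>

lemma answer_steps: "answer L P B T \<sigma> \<Longrightarrow> (ldnf_step L P)\<^sup>*\<^sup>* (B @ T) (subst_query \<sigma> T)"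
proof (induction rule: answer.induct)
  case (Pos H B \<rho> A Bs T \<theta> \<sigma>)
  have "ldnf_step L P (Pos A # Bs @ T) (subst_query \<theta> (subst_query \<rho> B @ Bs @ T))"
    using pos_resolventI[OF Pos(1-4)] by (intro ldnf_step.resolve resolvent.positive)
  with Pos(6) show ?case
    by (simp add: subst_query_subst_query converse_rtranclp_into_rtranclp)
next
  case (Neg A Bs T \<sigma>)
  have "ldnf_step L P (Neg A # Bs @ T) (Bs @ T)"
    using Neg(1,2) by (intro ldnf_step.resolve resolvent.negative)
  with Neg(4) show ?case
    by (simp add: converse_rtranclp_into_rtranclp)
qed simp

text \<open>Sequential composition of answers. While \<open>B\<close> is resolved, \<open>C\<close>
  belongs to the recorded tail, so the clauses used are already renamed apart from it. The equation
  for \<open>T'\<close> lets the induction instantiate both \<open>C\<close> and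
  \<open>T\<close>.\<close>

lemma answer_append:
  assumes "answer L P B T' \<sigma>" "T' = C @ T" "answer L P (subst_query \<sigma> C) (subst_query \<sigma> T) \<tau>"
  shows "answer L P (B @ C) T (\<lambda>x. subst_term \<tau> (\<sigma> x))"
  using assms
proof (induction arbitrary: C T rule: answer.induct)
  case (Pos H B \<rho> A Bs T' \<theta> \<sigma>)
  have "answer L P (subst_query \<theta> (subst_query \<rho> B @ Bs) @ subst_query \<theta> C) (subst_query \<theta> T)
      (\<lambda>x. subst_term \<tau> (\<sigma> x))"
    using Pos.prems by (intro Pos.IH) (simp_all add: subst_query_subst_query)
  then have "answer L P (Pos A # Bs @ C) T (\<lambda>x. subst_term (\<lambda>x. subst_term \<tau> (\<sigma> x)) (\<theta> x))"
    using Pos.hyps(1-4) Pos.prems by (intro answer.Pos) simp_all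
  then show ?case
    by (simp add: subst_term_subst_term)
next
  case (Neg A Bs T' \<sigma>)
  then show ?case
    by (simp add: answer.Neg)
qed simp

text \<open>Positive steps preserve truth because \<open>M\<close> is a model, negative ones by
  soundness of finite failure. A query may negate relations outside \<open>neg_rels P\<close>, where
  the completion says nothing; the result is applied to instances of parts of clause bodies.\<close>

lemma (in program_with_complete_model) answer_sound:
  assumes "answer L P B T \<sigma>" "wf_query L B" "\<And>A. Neg A \<in> set B \<Longrightarrow> rel_of A \<in> neg_rels P"
  shows "sat_query M v (subst_query \<sigma> B)"
  using assms
proof (induction rule: answer.induct)
  case (Pos H B \<rho> A Bs T \<theta> \<sigma>)
  have wf: "wf_query L (subst_query \<theta> (subst_query \<rho> B @ Bs))"
    using Pos.prems(1) wf_clause[OF Pos(1)] is_mguD(1)[OF Pos(4)] wf_subst_renaming[OF Pos(2)]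
    by (auto intro!: wf_subst_query)
  have neg: "rel_of A' \<in> neg_rels P"
    if "Neg A' \<in> set (subst_query \<theta> (subst_query \<rho> B @ Bs))" for A'
  proof -
    from that consider "Neg A' \<in> set (subst_query \<theta> (subst_query \<rho> B))"
      | "Neg A' \<in> set (subst_query \<theta> Bs)"
      by auto
    then show ?thesis
    proof cases
      case 1
      then show ?thesis using Pos(1) by (rule neg_rels_subst_query)
    next
      case 2
      then obtain l where l: "l \<in> set Bs" "Neg A' = subst_lit \<theta> l"
        by (auto simp: subst_query_def)
      from l(2) obtain A'' where "l = Neg A''"
        by (cases l) auto
      with l show ?thesis
        using Pos.prems(2)[of A''] by simp
    qed
  qed
  have sat: "sat_query M v (subst_query \<sigma> (subst_query \<theta> (subst_query \<rho> B @ Bs)))"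
    using Pos.IH[OF wf neg] .
  then have "sat_atom M v (subst_atom \<sigma> (subst_atom \<theta> (subst_atom \<rho> H)))"
    using model[OF Pos(1)] by (simp add: sat_query_subst sat_atom_subst)
  then have "sat_atom M v (subst_atom \<sigma> (subst_atom \<theta> A))"
    using is_mguD(2)[OF Pos(4)] by simp
  with sat show ?case
    by (simp add: subst_query_subst_query subst_atom_subst_atom)
next
  case (Neg A Bs T \<sigma>)
  have "rel_of A \<in> neg_rels_star P" "wf_atom L A"
    using Neg.prems neg_rels_subset_star[of P] by auto
  with Neg show ?case
    using finitely_failed_sound[of A v] by (simp add: subst_atom_ground)
qed simp

section \<open>Termination\<close>

lemma ldnf_step_simps [simp]:
  "\<not> ldnf_step L P [] Q'"
  "ldnf_step L P (Pos A # T) Q' \<longleftrightarrow> pos_resolvent L P A T Q'"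
  "ldnf_step L P (Neg A # T) Q' \<longleftrightarrow>
     vars_atom A = {} \<and> (finitely_failed L P [Pos A] \<and> Q' = T \<or> Q' = [Pos A])"
  by (auto simp: ldnf_step.simps resolvent.simps)

lemma ldnf_descendants_mono:
  assumes "(ldnf_step L P)\<^sup>*\<^sup>* Q Q'"
  shows "ldnf_descendants L P Q' \<subseteq> ldnf_descendants L P Q"
  using assms unfolding ldnf_descendants_def by auto

text \<open>The accessible part of the reversed step relation: a query terminates as soon as all its
  successors do.\<close>

abbreviation terminating ::
  "('p, 'f) signature \<Rightarrow> ('p, 'f, 'v) prog \<Rightarrow> ('p, 'f, 'v) query \<Rightarrow> bool" where
  "terminating L P \<equiv> Wellfounded.accp (\<lambda>Q' Q. ldnf_step L P Q Q')"

lemma terminating_Nil: "terminating L P []"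
  by (rule accp.accI) simp

lemma terminating_imp_finite:
  assumes "terminating L P Q"
  shows "all_ldnf_derivations_finite L P Q"
  using assms
proof (induction rule: accp.induct)
  case (accI Q)
  show ?case
    unfolding all_ldnf_derivations_finite_def
  proof
    assume "\<exists>q. q 0 = Q \<and> (\<forall>k. ldnf_step L P (q k) (q (Suc k)))"
    then obtain q where q: "q 0 = Q" "\<forall>k. ldnf_step L P (q k) (q (Suc k))" by blast
    then have "all_ldnf_derivations_finite L P (q 1)"
      using accI(2)[of "q 1"] by (metis One_nat_def)
    moreover have "\<exists>q'. q' 0 = q 1 \<and> (\<forall>k. ldnf_step L P (q' k) (q' (Suc k)))"
      using q(2) by (intro exI[of _ "\<lambda>k. q (Suc k)"]) simp
    ultimately show False
      unfolding all_ldnf_derivations_finite_def by blast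
  qed
qed

section \<open>Ranks and norms in an acceptable hierarchy\<close>

locale acceptable_hierarchy = program_with_complete_model L P M
  for L :: "('p, 'f) signature"
    and P :: "('p, 'f, 'v :: infinite) prog"
    and M :: "('p, 'f, 'd) interp" +
  fixes R :: "nat \<Rightarrow> ('p, 'f, 'v) prog"
    and n :: nat
    and lvl :: "nat \<Rightarrow> ('p, 'f, 'v) level_mapping"
  assumes const: "has_constant L"
    and P_eq: "P = (\<Union>i \<in> {1..n}. R i)"
    and hierarchy: "hierarchy n R"
    and acceptable: "i \<in> {1..n} \<Longrightarrow> acceptable L (R i) (lvl i) M"
begin

abbreviation safe :: "('p, 'f, 'v) query \<Rightarrow> bool" where
  "safe Q \<equiv> wf_query L Q \<and> strongly_bounded L n R lvl Q"

text \<open>The calls of a descendant are among the calls of the original query.\<close>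

lemma safe_steps:
  assumes "(ldnf_step L P)\<^sup>*\<^sup>* Q Q'" "safe Q"
  shows "safe Q'"
proof
  show "wf_query L Q'"
    using assms by (induction rule: rtranclp_induct) (auto intro: wf_ldnf_step)
  have "Call L P Q' \<subseteq> Call L P Q"
    using ldnf_descendants_mono[OF assms(1)] unfolding Call_def by blast
  with assms(2) show "strongly_bounded L n R lvl Q'"
    unfolding strongly_bounded_def P_eq by blast
qed

lemma safe_bounded:
  assumes "safe (Pos A # T)" "i \<in> {1..n}" "rel_of A \<in> defined_rels (R i)"
  shows "bounded_atom L (lvl i) A"
proof -
  have "Pos A \<in> Call L P (Pos A # T)"
    unfolding Call_def ldnf_descendants_def by force
  with assms show ?thesis
    unfolding strongly_bounded_def P_eq by blast
qed

text \<open>If \<open>k\<close> exceeded \<open>i\<close>, then \<open>R i\<close> would be part of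
  the union that \<open>R k\<close> extends, and no relation defined in \<open>R k\<close> could
  occur there.\<close>

lemma defined_le_occurring:
  assumes "p \<in> defined_rels (R k)" "p \<in> occurring_rels (R i)" "k \<in> {1..n}" "i \<in> {1..n}"
  shows "k \<le> i"
proof (rule ccontr)
  assume "\<not> k \<le> i"
  then obtain k' where k': "k = Suc k'" "i \<le> k'"
    by (metis Suc_leI less_eq_Suc_le not_less_eq_eq old.nat.exhaust le_zero_eq not0_implies_Suc)
  have "extends (R (Suc k')) (\<Union>j \<in> {1..k'}. R j)"
    using hierarchy k' assms(3,4) unfolding hierarchy_def by auto
  moreover have "p \<in> occurring_rels (\<Union>j \<in> {1..k'}. R j)"
    using assms(2,4) k'(2) unfolding occurring_rels_def defined_rels_def by fastforce
  ultimately show False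
    using assms(1) k'(1) unfolding extends_def by blast
qed

text \<open>In a hierarchy the set below has at most one element besides \<open>0\<close>, which is the value
  for relations without clauses.\<close>

definition rank :: "'p \<Rightarrow> nat" where
  "rank p = Max (insert 0 {i \<in> {1..n}. p \<in> defined_rels (R i)})"

text \<open>With \<open>rank_defined\<close>, this shows that the rank does not increase from a
  clause head to a body literal.\<close>

lemma rank_le:
  assumes "i \<in> {1..n}" "p \<in> occurring_rels (R i)"
  shows "rank p \<le> i"
  unfolding rank_def using assms defined_le_occurring by (subst Max_le_iff) auto

lemma rank_defined:
  assumes "i \<in> {1..n}" "p \<in> defined_rels (R i)"
  shows "rank p = i"
proof (rule antisym)
  show "rank p \<le> i"
    using assms by (intro rank_le) (auto simp: occurring_rels_def)
  show "i \<le> rank p"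
    unfolding rank_def using assms by (intro Max_ge) auto
qed

text \<open>Only meaningful if the maximum is over a finite set, that is, if \<open>A\<close> is bounded.\<close>

definition norm :: "('p, 'f, 'v) atom \<Rightarrow> nat" where
  "norm A = Max (lvl (rank (rel_of A)) ` ground_instances L A)"

lemma grounding:
  obtains \<kappa> :: "('f, 'v) subst" where "wf_subst L \<kappa>" "\<And>x. vars_term (\<kappa> x) = {}"
proof -
  obtain c where c: "fun_arity L c = 0"
    using const unfolding has_constant_def ..
  show thesis
    by (rule that[of "\<lambda>_. Fun c []"]) (simp_all add: wf_subst_def c)
qed

text \<open>Rests on the constant of the language; it ensures that \<open>norm\<close> takes the
  maximum of a non-empty set.\<close>

lemma ground_instances_nonempty:
  fixes A :: "('p, 'f, 'v) atom"
  shows "ground_instances L A \<noteq> {}"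
proof -
  obtain \<kappa> :: "('f, 'v) subst" where "wf_subst L \<kappa>" "\<And>x. vars_term (\<kappa> x) = {}"
    using grounding by blast
  then have "subst_atom \<kappa> A \<in> ground_instances L A"
    unfolding ground_instances_def by (auto simp: vars_atom_subst)
  then show ?thesis by blast
qed

lemma ground_instances_subst:
  "wf_subst L \<sigma> \<Longrightarrow> ground_instances L (subst_atom \<sigma> A) \<subseteq> ground_instances L A"
  unfolding ground_instances_def
  by (auto simp: subst_atom_subst_atom intro: wf_subst_comp)

text \<open>Acceptability speaks of ground clauses, so the grounding of \<open>b\<close> is extended
  to the whole clause. The literals in \<open>As\<close> remain true, since they hold under all
  valuations.\<close>

lemma level_body_less:
  assumes "i \<in> {1..n}" "(H, B) \<in> R i" "wf_subst L \<tau>" "subst_query \<tau> B = As @ b # Bs"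
    and "models_query M As" "X \<in> ground_instances L (atom_of b)"
  shows "\<exists>Y \<in> ground_instances L (subst_atom \<tau> H). lvl i X < lvl i Y"
proof -
  obtain \<sigma> where \<sigma>: "X = subst_atom \<sigma> (atom_of b)" "wf_subst L \<sigma>" "vars_atom X = {}"
    using assms(6) unfolding ground_instances_def by blast
  obtain \<kappa> :: "('f, 'v) subst" where \<kappa>: "wf_subst L \<kappa>" "\<And>x. vars_term (\<kappa> x) = {}"
    using grounding by blast
  \<comment> \<open>\<open>\<sigma>\<close> grounds \<open>b\<close> but perhaps not the rest of the
    clause; \<open>\<kappa>\<close> grounds what remains and leaves \<open>X\<close>
    unchanged.\<close>
  define \<gamma> where "\<gamma> = (\<lambda>x. subst_term \<kappa> (\<sigma> x))"
  have wf: "wf_subst L \<gamma>"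
    unfolding \<gamma>_def using \<kappa>(1) \<sigma>(2) by (rule wf_subst_comp)
  have ground: "vars_term (\<gamma> x) = {}" for x
    unfolding \<gamma>_def by (simp add: vars_term_subst \<kappa>(2))
  have X: "subst_atom \<gamma> (atom_of b) = X"
    unfolding \<gamma>_def using \<sigma>(1,3) by (metis subst_atom_subst_atom subst_atom_ground)
  let ?\<tau>\<gamma> = "\<lambda>x. subst_term \<gamma> (\<tau> x)"
  have "vars_clause (subst_clause ?\<tau>\<gamma> (H, B)) = {}"
    by (simp add: vars_atom_subst vars_query_subst vars_term_subst ground)
  moreover have "wf_subst L ?\<tau>\<gamma>"
    using wf assms(3) by (rule wf_subst_comp)
  ultimately have "subst_clause ?\<tau>\<gamma> (H, B) \<in> ground_prog L (R i)"
    using assms(2) unfolding ground_prog_def by blast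
  moreover have "subst_clause ?\<tau>\<gamma> (H, B) = (subst_atom \<gamma> (subst_atom \<tau> H),
      subst_query \<gamma> As @ subst_lit \<gamma> b # subst_query \<gamma> Bs)"
    using assms(4) by (simp add: subst_atom_subst_atom flip: subst_query_subst_query)
  moreover have "models_query M (subst_query \<gamma> As)"
    using assms(5) unfolding models_query_def by (simp add: sat_query_subst)
  ultimately have "lit_level (lvl i) (subst_lit \<gamma> b) < lvl i (subst_atom \<gamma> (subst_atom \<tau> H))"
    using acceptable[OF assms(1)] unfolding acceptable_def by metis
  moreover have "subst_atom \<gamma> (subst_atom \<tau> H) \<in> ground_instances L (subst_atom \<tau> H)"
    unfolding ground_instances_def using wf by (auto simp: vars_atom_subst ground)
  ultimately show ?thesis
    using X by (auto simp: lit_level_def)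
qed

text \<open>The instantiated head is also an instance of \<open>A\<close>, so its levels are at most
  \<open>norm A\<close>. Equality of ranks makes both norms refer to the same level mapping.\<close>

lemma norm_body_less:
  assumes "i \<in> {1..n}" "(H, B) \<in> R i" "wf_subst L \<tau>" "subst_query \<tau> B = As @ b # Bs"
    and "models_query M As" "subst_atom \<tau> H = subst_atom \<eta> A" "wf_subst L \<eta>"
    and "bounded_atom L (lvl i) A" "rank (rel_of (atom_of b)) = rank (rel_of A)"
  shows "norm (atom_of b) < norm A"
proof -
  have "rel_of A = rel_of H"
    using assms(6) by (metis rel_of_subst_atom)
  then have i: "rank (rel_of A) = i"
    using assms(1,2) by (intro rank_defined) (auto simp: defined_rels_def)
  have fin: "finite (lvl i ` ground_instances L A)"
    using assms(8) unfolding bounded_atom_def .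
  have less: "lvl i X < norm A" if X: "X \<in> ground_instances L (atom_of b)" for X
  proof -
    obtain Y where "Y \<in> ground_instances L (subst_atom \<tau> H)" "lvl i X < lvl i Y"
      using level_body_less[OF assms(1-5) X] by blast
    moreover from this have "Y \<in> ground_instances L A"
      using ground_instances_subst[OF assms(7), of A] assms(6) by auto
    then have "lvl i Y \<le> norm A"
      unfolding norm_def i by (intro Max_ge fin) simp
    ultimately show ?thesis by simp
  qed
  \<comment> \<open>The bound by \<open>norm A\<close> also gives boundedness of the body atom,
    which its own maximum requires.\<close>
  then have "lvl i ` ground_instances L (atom_of b) \<subseteq> {..<norm A}"
    by auto
  then have "finite (lvl i ` ground_instances L (atom_of b))"
    by (rule finite_subset) simp
  then show ?thesis
    unfolding norm_def[of "atom_of b"] assms(9) i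
    using less ground_instances_nonempty by (subst Max_less_iff) auto
qed

text \<open>The termination of the query after its first literal has been resolved is a hypothesis
  here, so that this is a property of the literal alone, on which one can do induction.\<close>

definition terminating_lit :: "('p, 'f, 'v) literal \<Rightarrow> bool" where
  "terminating_lit l \<longleftrightarrow> (\<forall>T. safe (l # T) \<longrightarrow>
     (\<forall>\<sigma>. answer L P [l] T \<sigma> \<longrightarrow> terminating L P (subst_query \<sigma> T)) \<longrightarrow>
     terminating L P (l # T))"

text \<open>The literals of \<open>B\<close> are consumed from the left: the tail hypothesis of
  \<open>terminating_lit\<close> for one literal is the termination of the remaining suffix, for
  every answer.\<close>

lemma terminating_append:
  assumes safe: "safe (B @ T)"
    and B: "\<And>As b Bs \<sigma>. B = As @ b # Bs \<Longrightarrow> answer L P As (b # Bs @ T) \<sigma> \<Longrightarrow>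
      terminating_lit (subst_lit \<sigma> b)"
    and T: "\<And>\<sigma>. answer L P B T \<sigma> \<Longrightarrow> terminating L P (subst_query \<sigma> T)"
  shows "terminating L P (B @ T)"
proof -
  \<comment> \<open>Generalised from \<open>B\<close> to any suffix left after an answer for the
    prefix \<open>As\<close>; the induction is on that suffix.\<close>
  have "terminating L P (subst_query \<sigma> (Bs @ T))"
    if "B = As @ Bs" "answer L P As (Bs @ T) \<sigma>" for As Bs \<sigma>
    using that
  proof (induction Bs arbitrary: As \<sigma>)
    case Nil
    then show ?case using T by simp
  next
    case (Cons b Bs)
    have "terminating_lit (subst_lit \<sigma> b)"
      using B Cons.prems by simp
    moreover have "safe (subst_query \<sigma> (b # Bs @ T))"
      using safe_steps[OF answer_steps[OF Cons.prems(2)]] safe Cons.prems(1) by simp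
    moreover have "terminating L P (subst_query \<tau> (subst_query \<sigma> (Bs @ T)))"
      if \<tau>: "answer L P [subst_lit \<sigma> b] (subst_query \<sigma> (Bs @ T)) \<tau>" for \<tau>
    proof -
      have "answer L P (As @ [b]) (Bs @ T) (\<lambda>x. subst_term \<tau> (\<sigma> x))"
        by (rule answer_append[OF Cons.prems(2)]) (use \<tau> in simp_all)
      then show ?thesis
        using Cons.IH[of "As @ [b]"] Cons.prems(1) by (simp add: subst_query_subst_query)
    qed
    ultimately show ?case
      unfolding terminating_lit_def by simp
  qed
  from this[of "[]" B Var] show ?thesis
    by (simp add: answer.Nil)
qed

text \<open>Lexicographic induction on rank, norm and sign. Resolution leads to body literals of
  smaller rank, or of equal rank and smaller norm; a subsidiary tree keeps the atom and drops the
  negation.\<close>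

lemma terminating_all_lits: "terminating_lit l"
proof (induction l rule: wf_induct_rule[OF wf_measures[of "[\<lambda>l. rank (rel_of (atom_of l)),
    \<lambda>l. norm (atom_of l), \<lambda>l. case l of Pos A \<Rightarrow> 0 | Neg A \<Rightarrow> 1]"]])
  case (1 l)
  show ?case
    unfolding terminating_lit_def
  proof (intro allI impI)
    fix T
    assume safe: "safe (l # T)"
      and ans: "\<forall>\<sigma>. answer L P [l] T \<sigma> \<longrightarrow> terminating L P (subst_query \<sigma> T)"
    have "terminating L P Q'" if step: "ldnf_step L P (l # T) Q'" for Q'
    proof (cases l)
      case (Pos A)
      then have res: "pos_resolvent L P A T Q'"
        using step by simp
      have "safe Q'"
        using safe_steps[OF r_into_rtranclp, OF step safe] .
      from res show ?thesis
      proof (cases rule: pos_resolventE)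
        case (1 H B \<rho> \<theta>)
        let ?B = "subst_query \<theta> (subst_query \<rho> B)"
        have Q': "Q' = ?B @ subst_query \<theta> T"
          using 1 by simp
        obtain i where i: "i \<in> {1..n}" "(H, B) \<in> R i"
          using 1(1) unfolding P_eq by blast
        have rel: "rel_of A = rel_of H"
          using is_mgu_rel_of[OF 1(4)] by simp
        then have "rel_of A \<in> defined_rels (R i)"
          using i(2) unfolding defined_rels_def by force
        then have bounded: "bounded_atom L (lvl i) A" and rank: "rank (rel_of A) = i"
          using safe_bounded[of A T i] safe i(1) rank_defined Pos by auto
        show ?thesis
          unfolding Q'
        proof (rule terminating_append)
          show "safe (?B @ subst_query \<theta> T)"
            using \<open>safe Q'\<close> unfolding Q' .
        next
          fix As b Bs \<sigma>
          assume B: "?B = As @ b # Bs" and As: "answer L P As (b # Bs @ subst_query \<theta> T) \<sigma>"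
          \<comment> \<open>Renaming, mgu and answer composed: the instance of the original clause
            to which acceptability applies.\<close>
          let ?\<tau> = "\<lambda>x. subst_term \<sigma> (subst_term \<theta> (\<rho> x))"
          have B\<tau>: "subst_query ?\<tau> B = subst_query \<sigma> As @ subst_lit \<sigma> b # subst_query \<sigma> Bs"
            using arg_cong[OF B, of "subst_query \<sigma>"]
            by (simp add: subst_query_subst_query)
          have wf: "wf_subst L \<sigma>" "wf_subst L \<theta>" "wf_subst L \<rho>"
            using answer_wf_subst[OF As] is_mguD(1)[OF 1(4)] wf_subst_renaming[OF 1(2)] by auto
          have "wf_query L As"
            using \<open>safe Q'\<close> unfolding Q' B by simp
          moreover have "rel_of A' \<in> neg_rels P" if "Neg A' \<in> set As" for A'
          proof -
            have "Neg A' \<in> set ?B"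
              using B that by simp
            then show ?thesis
              using 1(1) by (rule neg_rels_subst_query)
          qed
          ultimately have models: "models_query M (subst_query \<sigma> As)"
            unfolding models_query_def using answer_sound[OF As] by blast
          have "rel_of (atom_of b) \<in> (\<lambda>l. rel_of (atom_of l)) ` set ?B"
            unfolding B by simp
          then have "rel_of (atom_of b) \<in> (\<lambda>l. rel_of (atom_of l)) ` set B"
            unfolding rels_subst_query .
          then have "rel_of (atom_of b) \<in> occurring_rels (R i)"
            using i(2) unfolding occurring_rels_def by blast
          then have "rank (rel_of (atom_of (subst_lit \<sigma> b))) \<le> rank (rel_of A)"
            unfolding rank using i(1) by (simp add: rank_le)
          moreover have "norm (atom_of (subst_lit \<sigma> b)) < norm A"
            if "rank (rel_of (atom_of (subst_lit \<sigma> b))) = rank (rel_of A)"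
          proof (rule norm_body_less[OF i _ B\<tau> models _ _ bounded that])
            show "wf_subst L ?\<tau>" "wf_subst L (\<lambda>x. subst_term \<sigma> (\<theta> x))"
              using wf by (intro wf_subst_comp; simp)+
            show "subst_atom ?\<tau> H = subst_atom (\<lambda>x. subst_term \<sigma> (\<theta> x)) A"
              using is_mguD(2)[OF 1(4)] by (simp flip: subst_atom_subst_atom)
          qed
          ultimately show "terminating_lit (subst_lit \<sigma> b)"
            using Pos by (intro "1.IH") auto
        next
          fix \<sigma>
          assume "answer L P ?B (subst_query \<theta> T) \<sigma>"
          then have "answer L P [Pos A] T (\<lambda>x. subst_term \<sigma> (\<theta> x))"
            using 1 by (intro answer.Pos) simp_all
          then show "terminating L P (subst_query \<sigma> (subst_query \<theta> T))"
            using ans Pos by (simp add: subst_query_subst_query)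
        qed
      qed
    next
      case (Neg A)
      from step Neg consider
        (resolve) "vars_atom A = {}" "finitely_failed L P [Pos A]" "Q' = T"
        | (subsidiary) "vars_atom A = {}" "Q' = [Pos A]"
        by auto
      then show ?thesis
      proof cases
        case resolve
        \<comment> \<open>Removing a negative literal is an answer with the identity substitution,
          so \<open>ans\<close> covers \<open>T\<close> itself.\<close>
        then have "answer L P [l] T Var"
          unfolding Neg by (intro answer.Neg answer.Nil)
        with ans resolve(3) show ?thesis
          by fastforce
      next
        case subsidiary
        have "terminating_lit (Pos A)"
          using Neg by (intro 1) auto
        moreover have "safe [Pos A]"
          using safe_steps[OF r_into_rtranclp, OF step safe] subsidiary(2) by simp
        \<comment> \<open>With an empty tail, the tail hypothesis reduces to termination of the
          empty query.\<close>
        ultimately show ?thesis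
          unfolding terminating_lit_def subsidiary(2) by (simp add: terminating_Nil)
      qed
    qed
    then show "terminating L P (l # T)"
      by (rule accp.accI)
  qed
qed

lemma terminating_safe: "safe Q \<Longrightarrow> terminating L P Q"
  using terminating_append[of Q "[]"] terminating_all_lits by (simp add: terminating_Nil)

end

theorem theorem13:
  fixes L :: "('p, 'f) signature"
    and R :: "nat \<Rightarrow> ('p, 'f, 'v :: infinite) prog"
    and n :: nat
    and P :: "('p, 'f, 'v) prog"
    and lvl :: "nat \<Rightarrow> ('p, 'f, 'v) level_mapping"
    and M :: "('p, 'f, 'd) interp"
    and Q :: "('p, 'f, 'v) query"
  assumes "has_constant L"
    and "n \<ge> 1"
    and "\<And>i. i \<in> {1..n} \<Longrightarrow> program L (R i)"
    and "P = (\<Union>i \<in> {1..n}. R i)"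
    and "hierarchy n R"
    and "complete_model L P M"
    and "\<And>i. i \<in> {1..n} \<Longrightarrow> acceptable L (R i) (lvl i) M"
    and "wf_query L Q"
    and "strongly_bounded L n R lvl Q"
  shows "all_ldnf_derivations_finite L P Q"
proof -
  interpret acceptable_hierarchy L P M R n lvl
  proof
    show "program L P"
      using assms(3) unfolding assms(4) program_def by auto
  qed (use assms in auto)
  show ?thesis
    using terminating_safe terminating_imp_finite assms(8,9) by blast
qed

end
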